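(* Let $R$ be an associative ring with $1$, let $n\ge 4$, let $m\ge 2$, and let $I_1,\ldots,I_m$ be two-sided ideals of $R$. Consider an arbitrary arrangement of brackets $[\![\ldots]\!]$ on $m$ factors, with cut point $s$. Then $$[\![E(n,I_1),E(n,I_2),\ldots,E(n,I_m)]\!]=\big[E(n,I_1\circ\cdots\circ I_s),\,E(n,I_{s+1}\circ\cdots\circ I_m)\big],$$ where the bracketings of the symmetrised products $I_1\circ\cdots\circ I_s$ and $I_{s+1}\circ\cdots\circ I_m$ on the right-hand side coincide with the bracketings of the commutators of the first $s$ factors and of the last $m-s$ factors on the left-hand side.
   Context: Rings are associative with $1$, not necessarily commutative. For $1\le i\ne j\le n$ and $c\in R$, the elementary transvection is $t_{ij}(c)=e+c\,e_{ij}\in \mathrm{GL}(n,R)$, where $e$ is the identity matrix and $e_{ij}$ the standard matrix unit. For a two-sided ideal $A$ of $R$, the (unrelative) elementary subgroup of level $A$ is $E(n,A)=\langle t_{ij}(a) : 1\le i\ne j\le n,\ a\in A\rangle\le \mathrm{GL}(n,R)$. For two-sided ideals $A,B$ of $R$, $AB$ is the two-sided ideal additively generated by the products $ab$, $a\in A$, $b\in B$, and $A\circ B=AB+BA$ is the symmetrised product. This operation is not associative in general, so multiple symmetrised products require a specified bracketing. For elements $x,y$ of a group, $[x,y]=xyx^{-1}y^{-1}$. For subgroups $F,H$ of a group, $[F,H]$ is the subgroup generated by all $[f,h]$ with $f\in F$, $h\in H$. An arrangement of brackets $[\![H_1,\ldots,H_m]\!]$ is any full (binary) bracketing of the ordered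 sequence of subgroups $H_1,\ldots,H_m$ (in this order), with each pair of brackets interpreted as the mutual commutator subgroup of two subgroups; for $m=1$ it is just $H_1$. For $m\ge 2$, every such bracketing is uniquely of the form $[\![H_1,\ldots,H_m]\!]=\big[[\![H_1,\ldots,H_s]\!],[\![H_{s+1},\ldots,H_m]\!]\big]$ for some $s\in\{1,\ldots,m-1\}$ and some bracketings of the two inner sequences; this $s$ is called the cut point. The corresponding bracketing of a symmetrised product is obtained by replacing each subgroup $E(n,I_k)$ by the ideal $I_k$ and each commutator $[\cdot,\cdot]$ by $\circ$; for a single factor it is just that ideal. *)

theory Defs
  imports
    "HOL-Algebra.Ideal_Product"
    "HOL-Algebra.Generated_Groups"
    "Jordan_Normal_Form.Matrix"
begin

(* The matrices of AFP entry Jordan_Normal_Form serve as a container only: the ring structure comes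
   from the record R, not from a type class. Row and column indices run through 0, ..., n - 1. *)

definition matrix_monoid :: "('a, 'r) ring_scheme \<Rightarrow> nat \<Rightarrow> 'a mat monoid" where
  "matrix_monoid R n =
    \<lparr> carrier = {A \<in> carrier_mat n n. elements_mat A \<subseteq> carrier R},
      monoid.mult = (\<lambda>A B. mat n n (\<lambda>(i, j). \<Oplus>\<^bsub>R\<^esub>k\<in>{..<n}. A $$ (i, k) \<otimes>\<^bsub>R\<^esub> B $$ (k, j))),
      one = mat n n (\<lambda>(i, j). if i = j then \<one>\<^bsub>R\<^esub> else \<zero>\<^bsub>R\<^esub>) \<rparr>"

definition GL :: "('a, 'r) ring_scheme \<Rightarrow> nat \<Rightarrow> 'a mat monoid" where
  "GL R n = units_of (matrix_monoid R n)"

definition transvection ::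
    "('a, 'r) ring_scheme \<Rightarrow> nat \<Rightarrow> nat \<Rightarrow> nat \<Rightarrow> 'a \<Rightarrow> 'a mat" where
  "transvection R n i j c =
    mat n n (\<lambda>(k, l). (if k = l then \<one>\<^bsub>R\<^esub> else \<zero>\<^bsub>R\<^esub>) \<oplus>\<^bsub>R\<^esub> (if k = i \<and> l = j then c else \<zero>\<^bsub>R\<^esub>))"

definition elementary_subgroup ::
    "('a, 'r) ring_scheme \<Rightarrow> nat \<Rightarrow> 'a set \<Rightarrow> 'a mat set" where
  "elementary_subgroup R n A =
    generate (GL R n) {transvection R n i j a | i j a. i < n \<and> j < n \<and> i \<noteq> j \<and> a \<in> A}"

definition mutual_commutator ::
    "('g, 'b) monoid_scheme \<Rightarrow> 'g set \<Rightarrow> 'g set \<Rightarrow> 'g set" where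
  "mutual_commutator G F H =
    generate G {f \<otimes>\<^bsub>G\<^esub> h \<otimes>\<^bsub>G\<^esub> inv\<^bsub>G\<^esub> f \<otimes>\<^bsub>G\<^esub> inv\<^bsub>G\<^esub> h | f h. f \<in> F \<and> h \<in> H}"

(* The library's ideal_prod is the additive span of the products, for ideals of any ring. *)
definition symmetrised_product ::
    "('a, 'r) ring_scheme \<Rightarrow> 'a set \<Rightarrow> 'a set \<Rightarrow> 'a set" where
  "symmetrised_product R A B = ideal_prod R A B <+>\<^bsub>R\<^esub> ideal_prod R B A"

datatype bracketing =
    Single
  | Bracket (left_part: bracketing) (right_part: bracketing)

primrec num_factors :: "bracketing \<Rightarrow> nat" where
  "num_factors Single = 1"
| "num_factors (Bracket l r) = num_factors l + num_factors r"

(* For m = num_factors b, this is the value of the bracketing b, with the binary operation f in place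
   of each pair of brackets, on the consecutive factors x k, x (k + 1), ..., x (k + m - 1). *)
primrec bracketed ::
    "('s \<Rightarrow> 's \<Rightarrow> 's) \<Rightarrow> bracketing \<Rightarrow> (nat \<Rightarrow> 's) \<Rightarrow> nat \<Rightarrow> 's" where
  "bracketed f Single x k = x k"
| "bracketed f (Bracket l r) x k = f (bracketed f l x k) (bracketed f r x (k + num_factors l))"

(* Meaningful for num_factors b \<ge> 2 only: left_part Single and right_part Single are unspecified. *)
definition cut_point :: "bracketing \<Rightarrow> nat" where
  "cut_point b = num_factors (left_part b)"

end

theory Submission
  imports Defs
begin

text \<open>
  Only the Steinberg relations matter. Write \<open>E A\<close> for the elementary subgroup of level \<open>A\<close>,
  \<open>z\<^sub>i\<^sub>j(a, c)\<close> for the conjugate of \<open>t\<^sub>i\<^sub>j(a)\<close> by \<open>t\<^sub>j\<^sub>i(c)\<close>, and \<open>y\<^sub>i\<^sub>j(a, b) = [t\<^sub>i\<^sub>j(a), t\<^sub>j\<^sub>i(b)]\<close>.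
  The \<open>z\<^sub>i\<^sub>j(a, c)\<close> with \<open>a \<in> A\<close> generate a subgroup \<open>Z A\<close> that is normal in the absolute elementary
  group. The commutator \<open>K A B = [E A, E B]\<close> contains \<open>Z (A \<circ> B)\<close>, and modulo the latter the
  \<open>y\<^sub>i\<^sub>j(a, b)\<close> are central, independent of \<open>(i, j)\<close>, and generate \<open>K A B\<close>. Hence \<open>K A B\<close> is normal,
  which gives \<open>[Z A, Z B] = K A B\<close>.

  For \<open>n \<ge> 4\<close> an element of \<open>K A B\<close> can be written as \<open>u v\<close> with \<open>u \<in> Z (A \<circ> B)\<close> and \<open>v\<close> a product of
  \<open>y\<^sub>k\<^sub>l(a, b)\<close> for a fixed pair \<open>(k, l)\<close> disjoint from any prescribed pair. Choosing the pair so that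
  \<open>v\<close> commutes with the other argument of a commutator replaces \<open>K A B\<close> by \<open>Z (A \<circ> B)\<close>, which settles
  \<open>[K A B, E C]\<close> and \<open>[K A B, K C D]\<close>, and the theorem follows by induction on the bracketing.
\<close>

section \<open>Commutators in groups\<close>

definition conj_by :: "('g, 'b) monoid_scheme \<Rightarrow> 'g \<Rightarrow> 'g \<Rightarrow> 'g" where
  "conj_by G g x = g \<otimes>\<^bsub>G\<^esub> x \<otimes>\<^bsub>G\<^esub> inv\<^bsub>G\<^esub> g"

definition commutator :: "('g, 'b) monoid_scheme \<Rightarrow> 'g \<Rightarrow> 'g \<Rightarrow> 'g" where
  "commutator G x y = x \<otimes>\<^bsub>G\<^esub> y \<otimes>\<^bsub>G\<^esub> inv\<^bsub>G\<^esub> x \<otimes>\<^bsub>G\<^esub> inv\<^bsub>G\<^esub> y"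

context group
begin

lemma inv_mult_cancel:
  assumes "x \<in> carrier G" "y \<in> carrier G"
  shows "inv x \<otimes> (x \<otimes> y) = y" "x \<otimes> (inv x \<otimes> y) = y"
  using assms by (simp_all flip: m_assoc)

text \<open>Rewrites to right-nested words in which only letters are inverted and adjacent inverse
  pairs cancel. This is the normal form of the free group, so \<open>simp\<close> decides the
  commutator identities below.\<close>

lemmas group_word = m_assoc inv_mult_group inv_mult_cancel

lemma conjugate_closed [simp, intro]:
  "g \<in> carrier G \<Longrightarrow> x \<in> carrier G \<Longrightarrow> conj_by G g x \<in> carrier G"
  by (simp add: conj_by_def)

lemma commutator_closed [simp, intro]:
  "x \<in> carrier G \<Longrightarrow> y \<in> carrier G \<Longrightarrow> commutator G x y \<in> carrier G"
  by (simp add: commutator_def)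

lemma conjugate_mult:
  "g \<in> carrier G \<Longrightarrow> x \<in> carrier G \<Longrightarrow> y \<in> carrier G \<Longrightarrow>
    conj_by G g (x \<otimes> y) = conj_by G g x \<otimes> conj_by G g y"
  by (simp add: conj_by_def group_word)

lemma conjugate_one [simp]: "g \<in> carrier G \<Longrightarrow> conj_by G g \<one> = \<one>"
  by (simp add: conj_by_def)

lemma conjugate_by_one [simp]: "x \<in> carrier G \<Longrightarrow> conj_by G \<one> x = x"
  by (simp add: conj_by_def)

lemma conjugate_inv:
  "g \<in> carrier G \<Longrightarrow> x \<in> carrier G \<Longrightarrow> conj_by G g (inv x) = inv (conj_by G g x)"
  by (simp add: conj_by_def group_word)

lemma conjugate_by_mult:
  "g \<in> carrier G \<Longrightarrow> h \<in> carrier G \<Longrightarrow> x \<in> carrier G \<Longrightarrow>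
    conj_by G (g \<otimes> h) x = conj_by G g (conj_by G h x)"
  by (simp add: conj_by_def group_word)

lemma conjugate_eq_iff:
  assumes "g \<in> carrier G" "x \<in> carrier G" "y \<in> carrier G"
  shows "conj_by G g x = y \<longleftrightarrow> g \<otimes> x = y \<otimes> g"
  using assms by (metis conj_by_def inv_solve_right m_closed)

lemma commutator_eq_one_iff:
  assumes "x \<in> carrier G" "y \<in> carrier G"
  shows "commutator G x y = \<one> \<longleftrightarrow> x \<otimes> y = y \<otimes> x"
  using assms by (simp add: commutator_def inv_solve_right')

lemma commutator_conv_conjugate:
  "x \<in> carrier G \<Longrightarrow> y \<in> carrier G \<Longrightarrow> commutator G x y = x \<otimes> conj_by G y (inv x)"
  by (simp add: conj_by_def commutator_def group_word)

lemma conjugate_conv_commutator: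
  "x \<in> carrier G \<Longrightarrow> y \<in> carrier G \<Longrightarrow> conj_by G x y = commutator G x y \<otimes> y"
  by (simp add: conj_by_def commutator_def group_word)

lemma conjugate_commutator:
  "g \<in> carrier G \<Longrightarrow> x \<in> carrier G \<Longrightarrow> y \<in> carrier G \<Longrightarrow>
    conj_by G g (commutator G x y) = commutator G (conj_by G g x) (conj_by G g y)"
  by (simp add: commutator_def conjugate_mult conjugate_inv)

lemma inv_commutator:
  "x \<in> carrier G \<Longrightarrow> y \<in> carrier G \<Longrightarrow> inv (commutator G x y) = commutator G y x"
  by (simp add: commutator_def group_word)

lemma commutator_mult_left:
  "x \<in> carrier G \<Longrightarrow> y \<in> carrier G \<Longrightarrow> z \<in> carrier G \<Longrightarrow>
    commutator G (x \<otimes> y) z = conj_by G x (commutator G y z) \<otimes> commutator G x z"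
  by (simp add: commutator_def conj_by_def group_word)

lemma commutator_mult_right:
  "x \<in> carrier G \<Longrightarrow> y \<in> carrier G \<Longrightarrow> z \<in> carrier G \<Longrightarrow>
    commutator G x (y \<otimes> z) = commutator G x y \<otimes> conj_by G y (commutator G x z)"
  by (simp add: commutator_def conj_by_def group_word)

lemma commutator_inv_left:
  "x \<in> carrier G \<Longrightarrow> z \<in> carrier G \<Longrightarrow>
    commutator G (inv x) z = conj_by G (inv x) (inv (commutator G x z))"
  by (simp add: commutator_def conj_by_def group_word)

section \<open>Commutators modulo a normal subgroup and mutual commutator subgroups\<close>

lemma normal_conjugate_closed:
  "N \<lhd> G \<Longrightarrow> g \<in> carrier G \<Longrightarrow> x \<in> N \<Longrightarrow> conj_by G g x \<in> N"
  by (simp add: conj_by_def normal.inv_op_closed2)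

lemma mutual_commutator_conv:
  "mutual_commutator G F H = generate G {commutator G f h | f h. f \<in> F \<and> h \<in> H}"
  by (simp add: mutual_commutator_def commutator_def)

text \<open>This set is the preimage of the centraliser of the image of \<open>S\<close> in the
  quotient by \<open>N\<close>. The conjugations in the commutator identities are absorbed by
  normality.\<close>

lemma subgroup_commuting_mod:
  assumes N: "N \<lhd> G" and S: "S \<subseteq> carrier G"
  shows "subgroup {x \<in> carrier G. \<forall>s\<in>S. commutator G x s \<in> N} G"
proof -
  interpret N: normal N G by (rule N)
  show ?thesis
  proof (rule subgroupI)
    show "{x \<in> carrier G. \<forall>s\<in>S. commutator G x s \<in> N} \<noteq> {}"
      using S by (auto intro!: exI[of _ "\<one>"] simp: commutator_def subset_iff)
  next
    fix x assume x: "x \<in> {x \<in> carrier G. \<forall>s\<in>S. commutator G x s \<in> N}"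
    then show "inv x \<in> {x \<in> carrier G. \<forall>s\<in>S. commutator G x s \<in> N}"
      using S by (auto simp: commutator_inv_left subset_iff intro!: normal_conjugate_closed[OF N])
  next
    fix x y
    assume "x \<in> {x \<in> carrier G. \<forall>s\<in>S. commutator G x s \<in> N}"
      "y \<in> {x \<in> carrier G. \<forall>s\<in>S. commutator G x s \<in> N}"
    then show "x \<otimes> y \<in> {x \<in> carrier G. \<forall>s\<in>S. commutator G x s \<in> N}"
      using S by (auto simp: commutator_mult_left subset_iff
          intro!: normal_conjugate_closed[OF N])
  qed auto
qed

lemma commutator_swap_mem:
  assumes "subgroup N G" "x \<in> carrier G" "y \<in> carrier G" "commutator G x y \<in> N"
  shows "commutator G y x \<in> N"
  using assms inv_commutator subgroup.m_inv_closed by metis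

text \<open>One argument is extended at a time: first \<open>generate G S\<close> against
  \<open>T\<close>, then, after a swap, \<open>generate G T\<close> against all of
  \<open>generate G S\<close>. For trivial \<open>N\<close> the conclusion is that the two subgroups
  commute elementwise.\<close>

lemma commutator_generate_mem:
  assumes N: "N \<lhd> G" and S: "S \<subseteq> carrier G" and T: "T \<subseteq> carrier G"
    and ST: "\<And>s t. s \<in> S \<Longrightarrow> t \<in> T \<Longrightarrow> commutator G s t \<in> N"
    and x: "x \<in> generate G S" and y: "y \<in> generate G T"
  shows "commutator G x y \<in> N"
proof -
  have sub: "subgroup N G" by (rule normal_imp_subgroup[OF N])
  have genS: "generate G S \<subseteq> {x \<in> carrier G. \<forall>t\<in>T. commutator G x t \<in> N}"
    using S ST by (intro generate_subgroup_incl subgroup_commuting_mod N T) auto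
  have S': "generate G S \<subseteq> carrier G" by (rule generate_incl[OF S])
  have "commutator G t x \<in> N" if "t \<in> T" "x \<in> generate G S" for t x
    using that genS S' T by (intro commutator_swap_mem[OF sub, of x t]) auto
  then have "generate G T \<subseteq> {y \<in> carrier G. \<forall>s\<in>generate G S. commutator G y s \<in> N}"
    using T S' by (intro generate_subgroup_incl[OF _ subgroup_commuting_mod[OF N S']]) auto
  with x y S' show ?thesis
    using commutator_swap_mem[OF sub, of y x] by blast
qed

lemma mutual_commutator_subset:
  assumes "subgroup N G"
    and "\<And>f h. f \<in> F \<Longrightarrow> h \<in> H \<Longrightarrow> commutator G f h \<in> N"
  shows "mutual_commutator G F H \<subseteq> N"
  unfolding mutual_commutator_conv using assms by (intro generate_subgroup_incl) auto

lemma mutual_commutator_subgroup: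
  assumes "F \<subseteq> carrier G" "H \<subseteq> carrier G"
  shows "subgroup (mutual_commutator G F H) G"
  unfolding mutual_commutator_conv using assms by (intro generate_is_subgroup) auto

lemma commutator_mem_mutual_commutator:
  "f \<in> F \<Longrightarrow> h \<in> H \<Longrightarrow> commutator G f h \<in> mutual_commutator G F H"
  unfolding mutual_commutator_conv by (auto intro: generate.incl)

lemma mutual_commutator_commute:
  assumes "F \<subseteq> carrier G" "H \<subseteq> carrier G"
  shows "mutual_commutator G F H = mutual_commutator G H F"
proof -
  have "mutual_commutator G F H \<subseteq> mutual_commutator G H F"
    if carr: "F \<subseteq> carrier G" "H \<subseteq> carrier G" for F H
  proof (rule mutual_commutator_subset)
    show sub: "subgroup (mutual_commutator G H F) G"
      using carr by (intro mutual_commutator_subgroup)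
    show "commutator G f h \<in> mutual_commutator G H F" if "f \<in> F" "h \<in> H" for f h
      using that carr
      by (intro commutator_swap_mem[OF sub, of h f] commutator_mem_mutual_commutator) auto
  qed
  with assms show ?thesis by blast
qed

lemma mutual_commutator_mono:
  assumes "F' \<subseteq> carrier G" "H' \<subseteq> carrier G" "F \<subseteq> F'" "H \<subseteq> H'"
  shows "mutual_commutator G F H \<subseteq> mutual_commutator G F' H'"
  using assms by (intro mutual_commutator_subset mutual_commutator_subgroup)
    (auto intro: commutator_mem_mutual_commutator)

text \<open>Moves between \<open>GL R n\<close> and its subgroup generated by all transvections,
  where the Steinberg argument takes place.\<close>

lemma mutual_commutator_consistent:
  assumes "subgroup K G" "F \<subseteq> K" "H \<subseteq> K"
  shows "mutual_commutator (G\<lparr>carrier := K\<rparr>) F H = mutual_commutator G F H"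
proof -
  interpret K: subgroup K G by (rule assms)
  have eq: "{f \<otimes> h \<otimes> inv\<^bsub>G\<lparr>carrier := K\<rparr>\<^esub> f \<otimes> inv\<^bsub>G\<lparr>carrier := K\<rparr>\<^esub> h | f h. f \<in> F \<and> h \<in> H}
    = {f \<otimes> h \<otimes> inv f \<otimes> inv h | f h. f \<in> F \<and> h \<in> H}"
    using assms m_inv_consistent[OF assms(1)] by (smt (verit) Collect_cong subset_iff)
  have "mutual_commutator (G\<lparr>carrier := K\<rparr>) F H
     = generate (G\<lparr>carrier := K\<rparr>) {f \<otimes> h \<otimes> inv f \<otimes> inv h | f h. f \<in> F \<and> h \<in> H}"
    using eq by (simp add: mutual_commutator_def)
  also have "\<dots> = mutual_commutator G F H"
    unfolding mutual_commutator_def using assms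
    by (intro generate_consistent) (auto simp: subset_iff)
  finally show ?thesis .
qed

lemma conjugate_conjugate:
  "g \<in> carrier G \<Longrightarrow> h \<in> carrier G \<Longrightarrow> x \<in> carrier G \<Longrightarrow>
    conj_by G g (conj_by G h x) = conj_by G (conj_by G g h) (conj_by G g x)"
  by (simp add: conj_by_def group_word)

text \<open>Frees one argument of its conjugation at the price of conjugating the other by the
  inverse. Applied to \<open>z k l b c\<close> as second argument, it leaves the plain
  \<open>t k l b\<close> there.\<close>

lemma commutator_conj_by_right:
  "g \<in> carrier G \<Longrightarrow> x \<in> carrier G \<Longrightarrow> y \<in> carrier G \<Longrightarrow>
    commutator G x (conj_by G g y) = conj_by G g (commutator G (conj_by G (inv g) x) y)"
  by (simp add: conj_by_def commutator_def group_word)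

lemma commutator_mult_right_commuting:
  "x \<in> carrier G \<Longrightarrow> y \<in> carrier G \<Longrightarrow> w \<in> carrier G \<Longrightarrow> commutator G x w = \<one> \<Longrightarrow>
    commutator G x (y \<otimes> w) = commutator G x y"
  by (simp add: commutator_mult_right)

lemma commutator_mult_left_commuting:
  "x \<in> carrier G \<Longrightarrow> w \<in> carrier G \<Longrightarrow> y \<in> carrier G \<Longrightarrow> commutator G w y = \<one> \<Longrightarrow>
    commutator G (x \<otimes> w) y = commutator G x y"
  by (simp add: commutator_mult_left)

lemma one_normal: "{\<one>} \<lhd> G"
  by (simp add: normal_inv_iff triv_subgroup)

lemma bracketed_mutual_commutator_consistent:
  assumes K: "subgroup K G"
    and "\<And>j. k \<le> j \<Longrightarrow> j < k + num_factors b \<Longrightarrow> F j \<subseteq> K"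
  shows "bracketed (mutual_commutator (G\<lparr>carrier := K\<rparr>)) b F k = bracketed (mutual_commutator G) b F k
    \<and> bracketed (mutual_commutator G) b F k \<subseteq> K"
  using assms(2)
proof (induction b arbitrary: k)
  case Single
  then show ?case by simp
next
  case (Bracket l r)
  let ?L = "bracketed (mutual_commutator G) l F k"
  let ?R = "bracketed (mutual_commutator G) r F (k + num_factors l)"
  have L: "bracketed (mutual_commutator (G\<lparr>carrier := K\<rparr>)) l F k = ?L \<and> ?L \<subseteq> K"
    and R: "bracketed (mutual_commutator (G\<lparr>carrier := K\<rparr>)) r F (k + num_factors l) = ?R \<and> ?R \<subseteq> K"
    by (intro Bracket; simp)+
  then have "mutual_commutator G ?L ?R \<subseteq> K"
    by (intro mutual_commutator_subset[OF K])
      (auto simp: commutator_def subset_iff intro!: subgroup.m_closed[OF K] subgroup.m_inv_closed[OF K])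
  with L R show ?case
    by (simp add: mutual_commutator_consistent[OF K])
qed

end

lemma (in group_hom) commutator_img:
  "x \<in> carrier G \<Longrightarrow> y \<in> carrier G \<Longrightarrow> h (commutator G x y) = commutator H (h x) (h y)"
  by (simp add: commutator_def)

lemma (in group_hom) mutual_commutator_img:
  assumes "F \<subseteq> carrier G" "K \<subseteq> carrier G"
  shows "mutual_commutator H (h ` F) (h ` K) = h ` mutual_commutator G F K"
proof -
  have "{commutator H f k | f k. f \<in> h ` F \<and> k \<in> h ` K} = h ` {commutator G f k | f k. f \<in> F \<and> k \<in> K}"
  proof (intro equalityI subsetI)
    fix x assume "x \<in> {commutator H f k | f k. f \<in> h ` F \<and> k \<in> h ` K}"
    then obtain f k where "f \<in> F" "k \<in> K" "x = commutator H (h f) (h k)" by blast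
    then show "x \<in> h ` {commutator G f k | f k. f \<in> F \<and> k \<in> K}"
      using assms by (intro image_eqI[of _ _ "commutator G f k"]) (auto simp: commutator_img subset_iff)
  next
    fix x assume "x \<in> h ` {commutator G f k | f k. f \<in> F \<and> k \<in> K}"
    then obtain f k where "f \<in> F" "k \<in> K" "x = h (commutator G f k)" by blast
    moreover from this have "x = commutator H (h f) (h k)"
      using assms by (simp add: commutator_img subset_iff)
    ultimately show "x \<in> {commutator H f k | f k. f \<in> h ` F \<and> k \<in> h ` K}" by blast
  qed
  moreover have "{commutator G f k | f k. f \<in> F \<and> k \<in> K} \<subseteq> carrier G"
    using assms by auto
  ultimately show ?thesis
    by (simp add: G.mutual_commutator_conv H.mutual_commutator_conv generate_img)
qed

section \<open>Groups satisfying the Steinberg relations\<close>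

text \<open>Matrices are abstracted away so that quotients are models again. \<open>t_chain\<close>
  is the relation \<open>[t i j c, t j k d] = t i k (c d)\<close> without inverses, which can be
  checked in the matrix monoid. Since the \<open>t i j c\<close> generate, normality in
  \<open>G\<close> means normality in the absolute elementary group.\<close>

locale steinberg = ring R + G: group G
  for R :: "('a, 'r) ring_scheme" (structure) and G :: "('g, 'h) monoid_scheme" (structure) +
  fixes n :: nat and t :: "nat \<Rightarrow> nat \<Rightarrow> 'a \<Rightarrow> 'g"
  assumes n_ge: "n \<ge> 4"
    and t_closed [simp, intro]:
      "\<And>i j c. i < n \<Longrightarrow> j < n \<Longrightarrow> i \<noteq> j \<Longrightarrow> c \<in> carrier R \<Longrightarrow> t i j c \<in> carrier G"
    and t_add:
      "\<And>i j c d. i < n \<Longrightarrow> j < n \<Longrightarrow> i \<noteq> j \<Longrightarrow> c \<in> carrier R \<Longrightarrow> d \<in> carrier R \<Longrightarrow>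
        t i j (c \<oplus> d) = t i j c \<otimes>\<^bsub>G\<^esub> t i j d"
    and t_commute:
      "\<And>i j k l c d. i < n \<Longrightarrow> j < n \<Longrightarrow> i \<noteq> j \<Longrightarrow> k < n \<Longrightarrow> l < n \<Longrightarrow> k \<noteq> l \<Longrightarrow>
        j \<noteq> k \<Longrightarrow> i \<noteq> l \<Longrightarrow> c \<in> carrier R \<Longrightarrow> d \<in> carrier R \<Longrightarrow>
        t i j c \<otimes>\<^bsub>G\<^esub> t k l d = t k l d \<otimes>\<^bsub>G\<^esub> t i j c"
    and t_chain:
      "\<And>i j k c d. i < n \<Longrightarrow> j < n \<Longrightarrow> k < n \<Longrightarrow> i \<noteq> j \<Longrightarrow> j \<noteq> k \<Longrightarrow> i \<noteq> k \<Longrightarrow>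
        c \<in> carrier R \<Longrightarrow> d \<in> carrier R \<Longrightarrow>
        t i j c \<otimes>\<^bsub>G\<^esub> t j k d = t i k (c \<otimes> d) \<otimes>\<^bsub>G\<^esub> t j k d \<otimes>\<^bsub>G\<^esub> t i j c"
    and carrier_eq_generate:
      "carrier G = generate G {t i j c | i j c. i < n \<and> j < n \<and> i \<noteq> j \<and> c \<in> carrier R}"
begin

lemma third_index: obtains h where "h < n" "h \<noteq> i" "h \<noteq> j"
proof -
  have "\<exists>h. h < 3 \<and> h \<noteq> i \<and> h \<noteq> j" by presburger
  then obtain h where "h < 3" "h \<noteq> i" "h \<noteq> j" by blast
  with n_ge show ?thesis by (intro that[of h]) auto
qed

lemma t_zero: "i < n \<Longrightarrow> j < n \<Longrightarrow> i \<noteq> j \<Longrightarrow> t i j \<zero> = \<one>\<^bsub>G\<^esub>"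
  using t_add[of i j \<zero> \<zero>] G.l_cancel_one' by fastforce

lemma inv_t:
  assumes "i < n" "j < n" "i \<noteq> j" "c \<in> carrier R"
  shows "inv\<^bsub>G\<^esub> t i j c = t i j (\<ominus> c)"
  using assms t_add[of i j "\<ominus> c" c] by (intro G.inv_equality) (simp_all add: l_neg t_zero)

lemma conjugate_t_commute:
  "i < n \<Longrightarrow> j < n \<Longrightarrow> i \<noteq> j \<Longrightarrow> k < n \<Longrightarrow> l < n \<Longrightarrow> k \<noteq> l \<Longrightarrow> j \<noteq> k \<Longrightarrow> i \<noteq> l \<Longrightarrow>
    c \<in> carrier R \<Longrightarrow> d \<in> carrier R \<Longrightarrow> conj_by G (t i j c) (t k l d) = t k l d"
  by (simp add: G.conjugate_eq_iff t_commute)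

lemma conjugate_t_chain:
  assumes "i < n" "j < n" "k < n" "i \<noteq> j" "j \<noteq> k" "i \<noteq> k" "c \<in> carrier R" "d \<in> carrier R"
  shows "conj_by G (t i j c) (t j k d) = t i k (c \<otimes> d) \<otimes>\<^bsub>G\<^esub> t j k d"
  using assms by (simp add: G.conjugate_eq_iff t_chain)

lemma conjugate_t_chain':
  assumes "i < n" "j < n" "k < n" "i \<noteq> j" "j \<noteq> k" "i \<noteq> k" "c \<in> carrier R" "d \<in> carrier R"
  shows "conj_by G (t j k d) (t i j c) = t i k (\<ominus> (c \<otimes> d)) \<otimes>\<^bsub>G\<^esub> t i j c"
proof -
  have "t i j c \<otimes>\<^bsub>G\<^esub> t j k d = t i k (c \<otimes> d) \<otimes>\<^bsub>G\<^esub> (t j k d \<otimes>\<^bsub>G\<^esub> t i j c)"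
    using assms t_chain by (simp add: G.m_assoc)
  then have "t j k d \<otimes>\<^bsub>G\<^esub> t i j c = inv\<^bsub>G\<^esub> t i k (c \<otimes> d) \<otimes>\<^bsub>G\<^esub> (t i j c \<otimes>\<^bsub>G\<^esub> t j k d)"
    using assms by (simp add: G.inv_mult_cancel)
  then show ?thesis
    using assms by (simp add: G.conjugate_eq_iff inv_t G.m_assoc)
qed

text \<open>Computes the conjugate of any \<open>t k l d\<close> by any \<open>t i j c\<close>,
  except for the opposite pair \<open>(k, l) = (j, i)\<close>. Most of the work below consists in
  avoiding that pair.\<close>

lemmas conjugate_t = conjugate_t_commute conjugate_t_chain conjugate_t_chain'

lemma commutator_t_commute:
  "i < n \<Longrightarrow> j < n \<Longrightarrow> i \<noteq> j \<Longrightarrow> k < n \<Longrightarrow> l < n \<Longrightarrow> k \<noteq> l \<Longrightarrow> j \<noteq> k \<Longrightarrow> i \<noteq> l \<Longrightarrow>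
    c \<in> carrier R \<Longrightarrow> d \<in> carrier R \<Longrightarrow> commutator G (t i j c) (t k l d) = \<one>\<^bsub>G\<^esub>"
  by (simp add: G.commutator_eq_one_iff t_commute)

text \<open>The right-hand side is the commutator of \<open>t h j (-1)\<close> and
  \<open>t i h c\<close>. It trades the index pair \<open>(i, j)\<close> for \<open>(h, j)\<close>
  and \<open>(i, h)\<close>, neither of which is opposite to \<open>(j, i)\<close> or
  \<open>(i, j)\<close>.\<close>

lemma t_factor:
  assumes "i < n" "j < n" "h < n" "i \<noteq> j" "h \<noteq> i" "h \<noteq> j" "c \<in> carrier R"
  shows "t i j c = conj_by G (t h j (\<ominus> \<one>)) (t i h c) \<otimes>\<^bsub>G\<^esub> t i h (\<ominus> c)"
proof -
  have "t i h c \<otimes>\<^bsub>G\<^esub> t i h (\<ominus> c) = \<one>\<^bsub>G\<^esub>"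
    using assms by (simp flip: inv_t)
  then show ?thesis
    using assms by (simp add: conjugate_t r_minus G.m_assoc)
qed

text \<open>The group is generated by the \<open>t i j c\<close>, and their inverses have the same
  form by \<open>inv_t\<close>.\<close>

lemma normal_if_conjugate_t_closed:
  assumes W: "subgroup W G"
    and closed: "\<And>i j c w. i < n \<Longrightarrow> j < n \<Longrightarrow> i \<noteq> j \<Longrightarrow> c \<in> carrier R \<Longrightarrow> w \<in> W \<Longrightarrow>
      conj_by G (t i j c) w \<in> W"
  shows "W \<lhd> G"
proof -
  have "conj_by G g w \<in> W" if "g \<in> carrier G" "w \<in> W" for g w
    using that(1)[unfolded carrier_eq_generate] that(2)
  proof (induction arbitrary: w)
    case one
    then show ?case using W by (simp add: subgroup.mem_carrier)
  next
    case (incl h)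
    then show ?case using closed by auto
  next
    case (inv h)
    then show ?case using closed by (auto simp: inv_t)
  next
    case (eng h1 h2)
    then show ?case
      using W by (simp add: G.conjugate_by_mult subgroup.mem_carrier flip: carrier_eq_generate)
  qed
  with W show ?thesis
    by (simp add: G.normal_inv_iff conj_by_def)
qed

lemma normal_generate_if_conjugate_t_closed:
  assumes S: "S \<subseteq> carrier G"
    and closed: "\<And>i j c s. i < n \<Longrightarrow> j < n \<Longrightarrow> i \<noteq> j \<Longrightarrow> c \<in> carrier R \<Longrightarrow> s \<in> S \<Longrightarrow>
      conj_by G (t i j c) s \<in> generate G S"
  shows "generate G S \<lhd> G"
proof (rule normal_if_conjugate_t_closed)
  show sub: "subgroup (generate G S) G" by (rule G.generate_is_subgroup[OF S])
  fix i j c w assume ij: "i < n" "j < n" "i \<noteq> j" "c \<in> carrier R"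
  assume "w \<in> generate G S"
  then show "conj_by G (t i j c) w \<in> generate G S"
  proof induction
    case one
    then show ?case using ij by (simp add: generate.one)
  next
    case (incl h)
    then show ?case using ij closed by auto
  next
    case (inv h)
    then show ?case
      using ij closed S by (auto simp: G.conjugate_inv subgroup.m_inv_closed[OF sub] subset_iff)
  next
    case (eng h1 h2)
    then show ?case
      using ij by (simp add: G.conjugate_mult G.generate_in_carrier[OF S] generate.eng)
  qed
qed

section \<open>Elementary subgroups and their normal closures\<close>

definition E :: "'a set \<Rightarrow> 'g set" where
  "E A = generate G {t i j a | i j a. i < n \<and> j < n \<and> i \<noteq> j \<and> a \<in> A}"

definition z :: "nat \<Rightarrow> nat \<Rightarrow> 'a \<Rightarrow> 'a \<Rightarrow> 'g" where
  "z i j a c = conj_by G (t j i c) (t i j a)"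

text \<open>By \<open>E_subset_Z\<close> and \<open>normal_Z\<close> this is the normal closure of
  \<open>E A\<close>, known as the relative elementary subgroup; the generators \<open>z\<close> are
  those of Stein, Tits and Vaserstein.\<close>

definition Z :: "'a set \<Rightarrow> 'g set" where
  "Z A = generate G {z i j a c | i j a c. i < n \<and> j < n \<and> i \<noteq> j \<and> a \<in> A \<and> c \<in> carrier R}"

lemma z_closed [simp, intro]:
  "i < n \<Longrightarrow> j < n \<Longrightarrow> i \<noteq> j \<Longrightarrow> a \<in> carrier R \<Longrightarrow> c \<in> carrier R \<Longrightarrow> z i j a c \<in> carrier G"
  by (simp add: z_def)

lemma z_zero: "i < n \<Longrightarrow> j < n \<Longrightarrow> i \<noteq> j \<Longrightarrow> a \<in> carrier R \<Longrightarrow> z i j a \<zero> = t i j a"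
  by (simp add: z_def t_zero)

lemma t_mem_E: "i < n \<Longrightarrow> j < n \<Longrightarrow> i \<noteq> j \<Longrightarrow> a \<in> A \<Longrightarrow> t i j a \<in> E A"
  unfolding E_def by (rule generate.incl) blast

lemma z_mem_Z: "i < n \<Longrightarrow> j < n \<Longrightarrow> i \<noteq> j \<Longrightarrow> a \<in> A \<Longrightarrow> c \<in> carrier R \<Longrightarrow> z i j a c \<in> Z A"
  unfolding Z_def by (rule generate.incl) blast

end

locale steinberg_ideal = steinberg + A: ideal A R for A
begin

lemma subgroup_E: "subgroup (E A) G"
  unfolding E_def by (rule G.generate_is_subgroup) (auto simp: A.Icarr)

lemma subgroup_Z: "subgroup (Z A) G"
  unfolding Z_def by (rule G.generate_is_subgroup) (auto simp: A.Icarr)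

lemma t_mem_Z: "i < n \<Longrightarrow> j < n \<Longrightarrow> i \<noteq> j \<Longrightarrow> a \<in> A \<Longrightarrow> t i j a \<in> Z A"
  using z_mem_Z[of i j a A \<zero>] by (simp add: z_zero A.Icarr)

lemma E_subset_Z: "E A \<subseteq> Z A"
  unfolding E_def by (rule G.generate_subgroup_incl[OF _ subgroup_Z]) (auto intro: t_mem_Z)

lemmas A_closed = A.Icarr A.I_l_closed A.I_r_closed A.a_inv_closed

text \<open>\<open>t h j d\<close> only multiplies \<open>t i h a\<close> by a transvection with
  entry in \<open>A\<close>. Of the two resulting factors, just \<open>t i h a\<close> is opposite
  to \<open>t h i c\<close>, and it becomes a generator \<open>z\<close>.\<close>

lemma conjugate_row_mem_Z:
  assumes "i < n" "j < n" "h < n" "i \<noteq> j" "h \<noteq> i" "h \<noteq> j"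
    and "a \<in> A" "c \<in> carrier R" "d \<in> carrier R"
  shows "conj_by G (t h i c) (conj_by G (t h j d) (t i h a)) \<in> Z A"
proof -
  have "conj_by G (t h i c) (conj_by G (t h j d) (t i h a))
      = t h j (c \<otimes> \<ominus> (a \<otimes> d)) \<otimes>\<^bsub>G\<^esub> t i j (\<ominus> (a \<otimes> d)) \<otimes>\<^bsub>G\<^esub> z i h a c"
    using assms by (simp add: A_closed conjugate_t G.conjugate_mult z_def)
  moreover have "\<dots> \<in> Z A"
    using assms by (intro subgroup.m_closed[OF subgroup_Z] z_mem_Z t_mem_Z) (simp_all add: A_closed)
  ultimately show ?thesis by simp
qed

lemma conjugate_row_mem_Z':
  assumes "i < n" "j < n" "h < n" "i \<noteq> j" "h \<noteq> i" "h \<noteq> j"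
    and "a \<in> A" "c \<in> carrier R" "d \<in> carrier R"
  shows "conj_by G (t h j d) (conj_by G (t h i c) (t i h a)) \<in> Z A"
proof -
  have "conj_by G (t h j d) (conj_by G (t h i c) (t i h a))
     = conj_by G (t h i c) (conj_by G (t h j d) (t i h a))"
    using assms by (simp add: A_closed t_commute flip: G.conjugate_by_mult)
  with conjugate_row_mem_Z[OF assms] show ?thesis by simp
qed

text \<open>The cases list the positions of \<open>(k, l)\<close> relative to \<open>(i, j)\<close>.
  If \<open>(k, l)\<close> is neither \<open>(i, j)\<close> nor \<open>(j, i)\<close>, the
  conjugation can be computed with \<open>conjugate_t\<close>; \<open>(j, i)\<close> just adds the
  parameters, and \<open>(i, j)\<close> is the hard case.\<close>

lemma conjugate_t_z_mem_Z:
  assumes ij: "i < n" "j < n" "i \<noteq> j" and kl: "k < n" "l < n" "k \<noteq> l"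
    and a: "a \<in> A" and c: "c \<in> carrier R" and d: "d \<in> carrier R"
  shows "conj_by G (t k l d) (z i j a c) \<in> Z A"
proof -
  interpret Z: subgroup "Z A" G by (rule subgroup_Z)
  note aR = A.Icarr[OF a]
  \<comment> \<open>\<open>t h i d\<close> commutes with \<open>t j i c\<close>, so it acts on
    \<open>t i j a\<close> first. Cases 6 and 7 both end here.\<close>
  have column: "conj_by G (t h i d) (z i j a c) \<in> Z A"
    if h: "h < n" "h \<noteq> i" "h \<noteq> j" and d: "d \<in> carrier R" for h d
  proof -
    have "conj_by G (t h i d) (z i j a c)
        = conj_by G (t j i c) (conj_by G (t h i d) (t i j a))"
      using ij h a aR c d by (simp add: z_def t_commute flip: G.conjugate_by_mult)
    also have "\<dots> = conj_by G (t j i c) (t h j (d \<otimes> a)) \<otimes>\<^bsub>G\<^esub> z i j a c"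
      using ij h a aR c d by (simp add: conjugate_t G.conjugate_mult z_def)
    also have "\<dots> = t h i (\<ominus> (d \<otimes> a \<otimes> c)) \<otimes>\<^bsub>G\<^esub> t h j (d \<otimes> a) \<otimes>\<^bsub>G\<^esub> z i j a c"
      using ij h a aR c d by (simp add: conjugate_t)
    also have "\<dots> \<in> Z A"
      using ij h a aR c d by (intro Z.m_closed z_mem_Z t_mem_Z) (simp_all add: A_closed)
    finally show ?thesis .
  qed
  consider "k \<noteq> i" "k \<noteq> j" "l \<noteq> i" "l \<noteq> j" | "k = j" "l = i" | "k = i" "l = j"
    | "k = i" "l \<noteq> j" | "k = j" "l \<noteq> i" | "l = i" "k \<noteq> j" | "l = j" "k \<noteq> i"
    by blast
  then show ?thesis
  proof cases
    case 1
    then have "conj_by G (t k l d) (z i j a c) = z i j a c"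
      using ij kl c d aR by (simp add: z_def G.conjugate_conjugate conjugate_t)
    then show ?thesis using ij a c by (simp add: z_mem_Z)
  next
    case 2
    then have "conj_by G (t k l d) (z i j a c) = z i j a (d \<oplus> c)"
      using ij c d aR by (simp add: z_def t_add G.conjugate_by_mult)
    then show ?thesis using ij a c d by (simp add: z_mem_Z)
  next
    case 3
    \<comment> \<open>Write \<open>t\<^sub>i\<^sub>j(a) = [t\<^sub>h\<^sub>j(-1), t\<^sub>i\<^sub>h(a)]\<close>: conjugation turns the second argument into an element \<open>u\<close>
        of column \<open>h\<close> with entries in \<open>A\<close> and the first one into an element of row \<open>h\<close>.\<close>
    obtain h where h: "h < n" "h \<noteq> i" "h \<noteq> j" by (rule third_index)
    \<comment> \<open>The factors of \<open>u\<close> lie in column \<open>h\<close>, and the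
      element conjugating them will be \<open>t h i c\<close> times \<open>t h j f\<close>, in row
      \<open>h\<close>. Each factor thus meets only one opposite conjugation.\<close>
    have row: "conj_by G (t h i e) (conj_by G (t h j f) (t p h x)) \<in> Z A"
      if "p = i \<or> p = j" "e \<in> carrier R" "f \<in> carrier R" "x \<in> A" for p e f x
      using that ij h conjugate_row_mem_Z[of i j h x e f] conjugate_row_mem_Z'[of j i h x f e]
      by auto
    define u where "u = t i h (d \<otimes> (c \<otimes> a)) \<otimes>\<^bsub>G\<^esub> t j h (c \<otimes> a) \<otimes>\<^bsub>G\<^esub> t i h a"
    \<comment> \<open>The entry at \<open>(h, j)\<close> after both conjugations of
      \<open>t h j (-1)\<close>: passing \<open>t j i c\<close> creates the entry \<open>c\<close>
      at \<open>(h, i)\<close>, and passing \<open>t i j d\<close> turns this into an additional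
      \<open>-(c d)\<close>.\<close>
    define f where "f = \<ominus> (c \<otimes> d) \<oplus> \<ominus> \<one>"
    have f: "f \<in> carrier R" using c d by (simp add: f_def)
    have u: "conj_by G (t i j d) (conj_by G (t j i c) (t i h a)) = u"
      using ij h c d a aR by (simp add: conjugate_t G.conjugate_mult u_def G.m_assoc)
    have inv_u: "conj_by G (t i j d) (conj_by G (t j i c) (t i h (\<ominus> a))) = inv\<^bsub>G\<^esub> u"
      using ij h c d a aR by (simp add: G.conjugate_inv flip: inv_t u)
    have v: "conj_by G (t i j d) (conj_by G (t j i c) (t h j (\<ominus> \<one>))) = t h i c \<otimes>\<^bsub>G\<^esub> t h j f"
    proof -
      have "conj_by G (t i j d) (conj_by G (t j i c) (t h j (\<ominus> \<one>)))
          = t h j (\<ominus> (c \<otimes> d)) \<otimes>\<^bsub>G\<^esub> t h i c \<otimes>\<^bsub>G\<^esub> t h j (\<ominus> \<one>)"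
        using ij h c d by (simp add: conjugate_t G.conjugate_mult l_minus)
      also have "t h j (\<ominus> (c \<otimes> d)) \<otimes>\<^bsub>G\<^esub> t h i c = t h i c \<otimes>\<^bsub>G\<^esub> t h j (\<ominus> (c \<otimes> d))"
        using ij h c d by (simp add: t_commute)
      finally show ?thesis
        using ij h c d by (simp add: f_def t_add G.m_assoc)
    qed
    have u_Z: "u \<in> Z A"
      unfolding u_def using ij h a c d by (intro Z.m_closed t_mem_Z) (simp_all add: A_closed)
    have "conj_by G (t k l d) (z i j a c)
        = conj_by G (t i j d) (conj_by G (t j i c)
            (conj_by G (t h j (\<ominus> \<one>)) (t i h a) \<otimes>\<^bsub>G\<^esub> t i h (\<ominus> a)))"
      using 3 ij h aR c d by (simp add: z_def flip: t_factor)
    also have "\<dots> = conj_by G (t h i c \<otimes>\<^bsub>G\<^esub> t h j f) u \<otimes>\<^bsub>G\<^esub> inv\<^bsub>G\<^esub> u"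
      using ij h aR c d
      by (simp add: G.conjugate_mult inv_u
          G.conjugate_conjugate[of "t j i c" "t h j (\<ominus> \<one>)" "t i h a"]
          G.conjugate_conjugate[of "t i j d" "conj_by G (t j i c) (t h j (\<ominus> \<one>))"] u v)
    also have "conj_by G (t h i c \<otimes>\<^bsub>G\<^esub> t h j f) u \<in> Z A"
      unfolding u_def using ij h a aR c d f
      by (simp add: G.conjugate_by_mult G.conjugate_mult)
        (intro Z.m_closed row, simp_all add: A_closed)
    then have "conj_by G (t h i c \<otimes>\<^bsub>G\<^esub> t h j f) u \<otimes>\<^bsub>G\<^esub> inv\<^bsub>G\<^esub> u \<in> Z A"
      using u_Z by simp
    finally show ?thesis .
  next
    case 4
    \<comment> \<open>\<open>t i l d\<close> fixes \<open>t i j a\<close> and turns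
      \<open>t j i c\<close> into \<open>t j l (-(c d))\<close> times \<open>t j i c\<close>; both
      of these lie in row \<open>j\<close>.\<close>
    then have "conj_by G (t k l d) (z i j a c)
        = conj_by G (t j l (\<ominus> (c \<otimes> d))) (conj_by G (t j i c) (t i j a))"
      using ij kl c d aR
      by (simp add: z_def G.conjugate_conjugate[of "t i l d"] conjugate_t G.conjugate_by_mult)
    with 4 show ?thesis
      using ij kl a c d by (simp add: conjugate_row_mem_Z')
  next
    case 5
    then show ?thesis
      using ij kl a c d by (simp add: z_def conjugate_row_mem_Z')
  next
    case 6
    then show ?thesis using column kl d by blast
  next
    case 7
    \<comment> \<open>\<open>t k j d\<close> fixes \<open>t i j a\<close> and turns
      \<open>t j i c\<close> into \<open>t k i (d c)\<close> times \<open>t j i c\<close>, which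
      leads back to \<open>column\<close>.\<close>
    then have "conj_by G (t k l d) (z i j a c) = conj_by G (t k i (d \<otimes> c)) (z i j a c)"
      using ij kl c d aR
      by (simp add: z_def G.conjugate_conjugate[of "t k j d"] conjugate_t G.conjugate_by_mult)
    with 7 show ?thesis
      using kl c d column by simp
  qed
qed

lemma normal_Z: "Z A \<lhd> G"
  unfolding Z_def
  using conjugate_t_z_mem_Z[unfolded Z_def]
  by (intro normal_generate_if_conjugate_t_closed) (auto simp: A.Icarr)

end

section \<open>Elementary commutators: centrality and independence of the indices\<close>

context steinberg
begin

lemmas ideal_normal_Z = steinberg_ideal.normal_Z[OF steinberg_ideal.intro[OF steinberg_axioms]]
lemmas ideal_subgroup_E = steinberg_ideal.subgroup_E[OF steinberg_ideal.intro[OF steinberg_axioms]]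
lemmas ideal_E_subset_Z = steinberg_ideal.E_subset_Z[OF steinberg_ideal.intro[OF steinberg_axioms]]

lemma ideal_E_carrier: "ideal A R \<Longrightarrow> E A \<subseteq> carrier G"
  using ideal_subgroup_E subgroup.subset by blast

lemma ideal_Z_carrier: "ideal A R \<Longrightarrow> Z A \<subseteq> carrier G"
  using ideal_normal_Z normal_imp_subgroup subgroup.subset by blast

lemma ideal_mem_carrier: "ideal A R \<Longrightarrow> a \<in> A \<Longrightarrow> a \<in> carrier R"
  by (rule ideal.Icarr)

lemmas ideal_closed = ideal_mem_carrier ideal.I_l_closed ideal.I_r_closed
  additive_subgroup.a_inv_closed[OF ideal.axioms(1)]

abbreviation K :: "'a set \<Rightarrow> 'a set \<Rightarrow> 'g set" where
  "K A B \<equiv> mutual_commutator G (E A) (E B)"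

definition y :: "nat \<Rightarrow> nat \<Rightarrow> 'a \<Rightarrow> 'a \<Rightarrow> 'g" where
  "y i j a b = commutator G (t i j a) (t j i b)"

definition Y :: "nat \<Rightarrow> nat \<Rightarrow> 'a set \<Rightarrow> 'a set \<Rightarrow> 'g set" where
  "Y i j A B = generate G {y i j a b | a b. a \<in> A \<and> b \<in> B}"

lemma y_closed [simp, intro]:
  "i < n \<Longrightarrow> j < n \<Longrightarrow> i \<noteq> j \<Longrightarrow> a \<in> carrier R \<Longrightarrow> b \<in> carrier R \<Longrightarrow> y i j a b \<in> carrier G"
  by (simp add: y_def)

lemma inv_y:
  "i < n \<Longrightarrow> j < n \<Longrightarrow> i \<noteq> j \<Longrightarrow> a \<in> carrier R \<Longrightarrow> b \<in> carrier R \<Longrightarrow>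
    inv\<^bsub>G\<^esub> y i j a b = y j i b a"
  by (simp add: y_def G.inv_commutator)

lemma subgroup_Y:
  "i < n \<Longrightarrow> j < n \<Longrightarrow> i \<noteq> j \<Longrightarrow> ideal A R \<Longrightarrow> ideal B R \<Longrightarrow> subgroup (Y i j A B) G"
  unfolding Y_def by (rule G.generate_is_subgroup) (auto simp: ideal_mem_carrier)

text \<open>The quotient of a Steinberg group by \<open>Z (A \<circ> B)\<close> satisfies the assumptions below.\<close>

context
  fixes A B
  assumes A: "ideal A R" and B: "ideal B R"
    and vanish:
      "\<And>i j a b. i < n \<Longrightarrow> j < n \<Longrightarrow> i \<noteq> j \<Longrightarrow> a \<in> A \<Longrightarrow> b \<in> B \<Longrightarrow> t i j (a \<otimes> b) = \<one>\<^bsub>G\<^esub>"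
      "\<And>i j a b. i < n \<Longrightarrow> j < n \<Longrightarrow> i \<noteq> j \<Longrightarrow> a \<in> A \<Longrightarrow> b \<in> B \<Longrightarrow> t i j (b \<otimes> a) = \<one>\<^bsub>G\<^esub>"
begin

private lemma AR: "a \<in> A \<Longrightarrow> a \<in> carrier R" by (rule ideal_mem_carrier[OF A])
private lemma BR: "b \<in> B \<Longrightarrow> b \<in> carrier R" by (rule ideal_mem_carrier[OF B])

private lemmas AB_closed = AR BR ideal.I_l_closed[OF A] ideal.I_r_closed[OF A]
  ideal.I_l_closed[OF B] ideal.I_r_closed[OF B] ideal_closed(4)[OF A] ideal_closed(4)[OF B]

text \<open>By the chain relation such a commutator is trivial or a transvection whose entry is, up
  to sign, a product from \<open>A\<close> and \<open>B\<close>; the latter vanish here.\<close>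

lemma commutator_t_not_opposite:
  assumes "i < n" "j < n" "i \<noteq> j" "k < n" "l < n" "k \<noteq> l" "k \<noteq> j \<or> l \<noteq> i" "a \<in> A" "b \<in> B"
  shows "commutator G (t i j a) (t k l b) = \<one>\<^bsub>G\<^esub>"
proof -
  consider "k \<noteq> j" "l \<noteq> i" | "k = j" "l \<noteq> i" | "k \<noteq> j" "l = i" using assms by blast
  then show ?thesis
  proof cases
    case 1
    then show ?thesis using assms by (simp add: commutator_t_commute AR BR)
  next
    case 2
    then show ?thesis
      using assms t_chain[of i j l a b] by (simp add: G.commutator_eq_one_iff AR BR vanish)
  next
    case 3
    then show ?thesis
      using assms t_chain[of k i j b a] by (simp add: G.commutator_eq_one_iff AR BR vanish)
  qed
qed

text \<open>Conjugation changes at most one argument of the commutator, by a factor with entry in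
  the same ideal. That factor is not opposite to the other argument, so it commutes with it and
  drops out.\<close>

private lemma conj_by_t_y_aux:
  assumes "i < n" "j < n" "i \<noteq> j" "k < n" "l < n" "k \<noteq> l" "a \<in> A" "b \<in> B" "c \<in> carrier R"
    and "{i, j} \<noteq> {k, l}"
  shows "conj_by G (t k l c) (y i j a b) = y i j a b"
proof -
  have carr: "a \<in> carrier R" "b \<in> carrier R" using assms by (simp_all add: AR BR)
  have y: "conj_by G (t k l c) (y i j a b)
      = commutator G (conj_by G (t k l c) (t i j a)) (conj_by G (t k l c) (t j i b))"
    using assms by (simp add: y_def G.conjugate_commutator AR BR)
  consider "k \<noteq> i" "k \<noteq> j" "l \<noteq> i" "l \<noteq> j" | "k = i" "l \<noteq> i" "l \<noteq> j" | "k = j" "l \<noteq> i" "l \<noteq> j"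
    | "l = i" "k \<noteq> i" "k \<noteq> j" | "l = j" "k \<noteq> i" "k \<noteq> j"
    using assms by auto
  then show ?thesis
  proof cases
    case 1
    then show ?thesis using assms by (simp add: conjugate_t AR BR y_def G.conjugate_commutator)
  next
    case 2
    have moved: "conj_by G (t k l c) (t j i b) = t j i b \<otimes>\<^bsub>G\<^esub> t j l (\<ominus> (b \<otimes> c))"
      using 2 assms by (simp add: conjugate_t AB_closed t_commute)
    have fixed: "conj_by G (t k l c) (t i j a) = t i j a"
      using 2 assms by (simp add: conjugate_t AB_closed)
    have one: "commutator G (t i j a) (t j l (\<ominus> (b \<otimes> c))) = \<one>\<^bsub>G\<^esub>"
      using 2 assms by (intro commutator_t_not_opposite) (simp_all add: AB_closed)
    show ?thesis
      unfolding y moved fixed unfolding y_def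
      using 2 assms carr by (intro G.commutator_mult_right_commuting one) simp_all
  next
    case 3
    have moved: "conj_by G (t k l c) (t i j a) = t i j a \<otimes>\<^bsub>G\<^esub> t i l (\<ominus> (a \<otimes> c))"
      using 3 assms by (simp add: conjugate_t AB_closed t_commute)
    have fixed: "conj_by G (t k l c) (t j i b) = t j i b"
      using 3 assms by (simp add: conjugate_t AB_closed)
    have one: "commutator G (t i l (\<ominus> (a \<otimes> c))) (t j i b) = \<one>\<^bsub>G\<^esub>"
      using 3 assms by (intro commutator_t_not_opposite) (simp_all add: AB_closed)
    show ?thesis
      unfolding y moved fixed unfolding y_def
      using 3 assms carr by (intro G.commutator_mult_left_commuting one) simp_all
  next
    case 4
    have moved: "conj_by G (t k l c) (t i j a) = t i j a \<otimes>\<^bsub>G\<^esub> t k j (c \<otimes> a)"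
      using 4 assms by (simp add: conjugate_t AB_closed t_commute)
    have fixed: "conj_by G (t k l c) (t j i b) = t j i b"
      using 4 assms by (simp add: conjugate_t AB_closed)
    have one: "commutator G (t k j (c \<otimes> a)) (t j i b) = \<one>\<^bsub>G\<^esub>"
      using 4 assms by (intro commutator_t_not_opposite) (simp_all add: AB_closed)
    show ?thesis
      unfolding y moved fixed unfolding y_def
      using 4 assms carr by (intro G.commutator_mult_left_commuting one) simp_all
  next
    case 5
    have moved: "conj_by G (t k l c) (t j i b) = t j i b \<otimes>\<^bsub>G\<^esub> t k i (c \<otimes> b)"
      using 5 assms by (simp add: conjugate_t AB_closed t_commute)
    have fixed: "conj_by G (t k l c) (t i j a) = t i j a"
      using 5 assms by (simp add: conjugate_t AB_closed)
    have one: "commutator G (t i j a) (t k i (c \<otimes> b)) = \<one>\<^bsub>G\<^esub>"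
      using 5 assms by (intro commutator_t_not_opposite) (simp_all add: AB_closed)
    show ?thesis
      unfolding y moved fixed unfolding y_def
      using 5 assms carr by (intro G.commutator_mult_right_commuting one) simp_all
  qed
qed

text \<open>If \<open>{k, l} = {i, j}\<close>, then \<open>t_factor\<close> expresses
  \<open>t k l c\<close> through the pairs \<open>(h, l)\<close> and \<open>(k, h)\<close>, which
  the auxiliary lemma covers.\<close>

private lemma conj_by_t_y:
  assumes "i < n" "j < n" "i \<noteq> j" "k < n" "l < n" "k \<noteq> l" "a \<in> A" "b \<in> B" "c \<in> carrier R"
  shows "conj_by G (t k l c) (y i j a b) = y i j a b"
proof (cases "{i, j} = {k, l}")
  case True
  obtain h where "h < n" "h \<noteq> k" "h \<noteq> l" by (rule third_index)
  moreover from this True have "{i, j} \<noteq> {h, l}" "{i, j} \<noteq> {k, h}" by auto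
  ultimately show ?thesis
    using assms
    by (subst t_factor[of k l h c])
      (simp_all add: G.conjugate_by_mult conj_by_t_y_aux AR BR inv_t
        conj_by_def[of G "t h l (\<ominus> \<one>)" "t k h c"])
next
  case False
  with assms show ?thesis by (intro conj_by_t_y_aux)
qed

lemma conj_by_y:
  assumes ij: "i < n" "j < n" "i \<noteq> j" "a \<in> A" "b \<in> B" and g: "g \<in> carrier G"
  shows "conj_by G g (y i j a b) = y i j a b"
  using g[unfolded carrier_eq_generate]
proof induction
  case one
  then show ?case using ij by (simp add: AR BR)
next
  case (incl h)
  then show ?case using ij by (auto intro: conj_by_t_y)
next
  case (inv h)
  then show ?case using ij by (auto simp: conj_by_t_y inv_t)
next
  case (eng g h)
  then show ?case
    using ij by (simp add: G.conjugate_by_mult AR BR flip: carrier_eq_generate)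
qed

text \<open>Multiplying the first argument by \<open>t i h a\<close> does not change
  \<open>y i j a b\<close>, and the result is the conjugate under \<open>t h j (-1)\<close> of the
  commutator of \<open>t i h a\<close> with \<open>t h i b\<close> times \<open>t j i b\<close>.
  There \<open>t j i b\<close> drops out as well, and by centrality so does the conjugation.\<close>

lemma y_shift_right:
  assumes ij: "i < n" "j < n" "i \<noteq> j" and h: "h < n" "h \<noteq> i" "h \<noteq> j" and a: "a \<in> A" and b: "b \<in> B"
  shows "y i j a b = y i h a b"
proof -
  define g where "g = t h j (\<ominus> \<one>)"
  have g: "g \<in> carrier G" using ij h by (simp add: g_def)
  have tij: "conj_by G g (t i h a) = t i h a \<otimes>\<^bsub>G\<^esub> t i j a"
    using ij h a by (simp add: g_def conjugate_t AR t_commute r_minus)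
  have tji: "conj_by G g (t h i b \<otimes>\<^bsub>G\<^esub> t j i b) = t j i b"
  proof -
    have "conj_by G g (t j i b) = inv\<^bsub>G\<^esub> t h i b \<otimes>\<^bsub>G\<^esub> t j i b"
      using ij h b by (simp add: g_def conjugate_t BR l_minus inv_t)
    moreover have "conj_by G g (t h i b) = t h i b"
      using ij h b by (simp add: g_def conjugate_t BR)
    ultimately show ?thesis
      using ij h b g by (simp add: BR G.conjugate_mult G.inv_mult_cancel)
  qed
  have "y i j a b = commutator G (t i h a \<otimes>\<^bsub>G\<^esub> t i j a) (t j i b)"
  proof -
    have "commutator G (t i h a) (t j i b) = \<one>\<^bsub>G\<^esub>"
      using ij h a b by (intro commutator_t_not_opposite) auto
    moreover have "conj_by G (t i h a) (y i j a b) = y i j a b"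
      using ij h a b by (intro conj_by_y) (auto simp: AR)
    ultimately show ?thesis
      using ij h a b by (simp add: G.commutator_mult_left AR BR flip: y_def)
  qed
  also have "\<dots> = conj_by G g (commutator G (t i h a) (t h i b \<otimes>\<^bsub>G\<^esub> t j i b))"
    using ij h a b g by (simp add: G.conjugate_commutator AR BR tij tji)
  also have "\<dots> = conj_by G g (y i h a b)"
    using ij h a b by (simp add: G.commutator_mult_right AR BR commutator_t_not_opposite y_def)
  also have "\<dots> = y i h a b"
    using ij h a b g by (simp add: conj_by_y)
  finally show ?thesis .
qed

lemma Y_normal:
  assumes kl: "k < n" "l < n" "k \<noteq> l"
  shows "Y k l A B \<lhd> G"
  unfolding Y_def
proof (rule G.normal_generateI)
  show "{y k l a b | a b. a \<in> A \<and> b \<in> B} \<subseteq> carrier G"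
    using kl by (auto simp: AR BR)
  show "g \<otimes>\<^bsub>G\<^esub> h \<otimes>\<^bsub>G\<^esub> inv\<^bsub>G\<^esub> g \<in> {y k l a b | a b. a \<in> A \<and> b \<in> B}"
    if "h \<in> {y k l a b | a b. a \<in> A \<and> b \<in> B}" "g \<in> carrier G" for h g
    using that kl conj_by_y[of k l _ _ g] by (auto simp: conj_by_def)
qed

lemma Y_central:
  assumes kl: "k < n" "l < n" "k \<noteq> l" and x: "x \<in> Y k l A B" and g: "g \<in> carrier G"
  shows "conj_by G g x = x"
  using x[unfolded Y_def]
proof induction
  case one
  then show ?case using g by simp
next
  case (incl h)
  then show ?case using kl g by (auto simp: conj_by_y)
next
  case (inv h)
  then show ?case using kl g by (auto simp: conj_by_y G.conjugate_inv AR BR)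
next
  case (eng h1 h2)
  moreover have "{y k l a b | a b. a \<in> A \<and> b \<in> B} \<subseteq> carrier G"
    using kl by (auto simp: AR BR)
  ultimately show ?case using g by (simp add: G.conjugate_mult G.generate_in_carrier)
qed

end

text \<open>Inversion exchanges the two indices together with the two ideals. The lemma stands
  outside the context above because it applies \<open>y_shift_right\<close> with \<open>A\<close>
  and \<open>B\<close> exchanged.\<close>

lemma y_shift_left:
  assumes "ideal A R" "ideal B R"
    and "\<And>i j a b. i < n \<Longrightarrow> j < n \<Longrightarrow> i \<noteq> j \<Longrightarrow> a \<in> A \<Longrightarrow> b \<in> B \<Longrightarrow> t i j (a \<otimes> b) = \<one>\<^bsub>G\<^esub>"
    and "\<And>i j a b. i < n \<Longrightarrow> j < n \<Longrightarrow> i \<noteq> j \<Longrightarrow> a \<in> A \<Longrightarrow> b \<in> B \<Longrightarrow> t i j (b \<otimes> a) = \<one>\<^bsub>G\<^esub>"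
    and "i < n" "j < n" "i \<noteq> j" "h < n" "h \<noteq> i" "h \<noteq> j" "a \<in> A" "b \<in> B"
  shows "y i j a b = y h j a b"
proof -
  have "y j i b a = y j h b a"
    using assms by (intro y_shift_right[of B A]) auto
  then have "inv\<^bsub>G\<^esub> y j i b a = inv\<^bsub>G\<^esub> y j h b a" by simp
  then show ?thesis
    using assms by (simp add: inv_y ideal_mem_carrier[of A] ideal_mem_carrier[of B])
qed

lemma y_independent:
  assumes ideals: "ideal A R" "ideal B R"
    and vanish:
      "\<And>i j a b. i < n \<Longrightarrow> j < n \<Longrightarrow> i \<noteq> j \<Longrightarrow> a \<in> A \<Longrightarrow> b \<in> B \<Longrightarrow> t i j (a \<otimes> b) = \<one>\<^bsub>G\<^esub>"
      "\<And>i j a b. i < n \<Longrightarrow> j < n \<Longrightarrow> i \<noteq> j \<Longrightarrow> a \<in> A \<Longrightarrow> b \<in> B \<Longrightarrow> t i j (b \<otimes> a) = \<one>\<^bsub>G\<^esub>"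
    and ij: "i < n" "j < n" "i \<noteq> j" and kl: "k < n" "l < n" "k \<noteq> l" and ab: "a \<in> A" "b \<in> B"
  shows "y i j a b = y k l a b"
proof -
  have right: "y i j a b = y i h a b" if "i < n" "j < n" "i \<noteq> j" "h < n" "h \<noteq> i" for i j h
    using that ab vanish by (cases "h = j") (auto intro: y_shift_right[OF ideals])
  have left: "y i j a b = y h j a b" if "i < n" "j < n" "i \<noteq> j" "h < n" "h \<noteq> j" for i j h
    using that ab vanish by (cases "h = i") (auto intro: y_shift_left[OF ideals])
  \<comment> \<open>The path \<open>(i, j)\<close>, \<open>(i, h)\<close>, \<open>(k, h)\<close>,
    \<open>(k, l)\<close> changes one index at a time and never makes the two indices equal, even if
    \<open>k = j\<close> or \<open>l = i\<close>.\<close>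
  obtain h where h: "h < n" "h \<noteq> i" "h \<noteq> k" by (rule third_index)
  have "y i j a b = y i h a b" using ij h by (intro right)
  also have "\<dots> = y k h a b" using ij kl h by (intro left) auto
  also have "\<dots> = y k l a b" using kl h by (intro right) auto
  finally show ?thesis .
qed

text \<open>On generators the commutator is trivial or some \<open>y i j a b\<close>, which equals
  \<open>y k l a b\<close>. Normality of \<open>Y k l A B\<close> extends this to \<open>E A\<close>
  and \<open>E B\<close>.\<close>

lemma K_subset_Y:
  assumes ideals: "ideal A R" "ideal B R"
    and vanish:
      "\<And>i j a b. i < n \<Longrightarrow> j < n \<Longrightarrow> i \<noteq> j \<Longrightarrow> a \<in> A \<Longrightarrow> b \<in> B \<Longrightarrow> t i j (a \<otimes> b) = \<one>\<^bsub>G\<^esub>"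
      "\<And>i j a b. i < n \<Longrightarrow> j < n \<Longrightarrow> i \<noteq> j \<Longrightarrow> a \<in> A \<Longrightarrow> b \<in> B \<Longrightarrow> t i j (b \<otimes> a) = \<one>\<^bsub>G\<^esub>"
    and kl: "k < n" "l < n" "k \<noteq> l"
  shows "K A B \<subseteq> Y k l A B"
proof (rule G.mutual_commutator_subset)
  have normal: "Y k l A B \<lhd> G" using ideals vanish kl by (rule Y_normal)
  then show sub: "subgroup (Y k l A B) G" by (rule normal_imp_subgroup)
  have gens: "commutator G s t' \<in> Y k l A B"
    if "s \<in> {t i j a | i j a. i < n \<and> j < n \<and> i \<noteq> j \<and> a \<in> A}"
      "t' \<in> {t i j b | i j b. i < n \<and> j < n \<and> i \<noteq> j \<and> b \<in> B}" for s t'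
  proof -
    from that obtain i j a p q b where s: "s = t i j a" "i < n" "j < n" "i \<noteq> j" "a \<in> A"
      and t': "t' = t p q b" "p < n" "q < n" "p \<noteq> q" "b \<in> B" by blast
    show ?thesis
    proof (cases "p = j \<and> q = i")
      case True
      then have "commutator G s t' = y k l a b"
        using s t' y_independent[OF ideals vanish, of i j k l a b] kl by (simp add: y_def)
      then show ?thesis
        unfolding Y_def using s t' by (auto intro: generate.incl)
    next
      case False
      then show ?thesis
        using s t' commutator_t_not_opposite[OF ideals vanish, of i j p q a b] subgroup.one_closed[OF sub] by auto
    qed
  qed
  show "commutator G f h \<in> Y k l A B" if "f \<in> E A" "h \<in> E B" for f h
    using that unfolding E_def
    by (rule G.commutator_generate_mem[OF normal, rotated -2])
      (auto intro: gens simp: ideal_mem_carrier[OF ideals(1)] ideal_mem_carrier[OF ideals(2)])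
qed

section \<open>Passage to homomorphic images\<close>

lemma steinberg_image:
  assumes h: "group_hom G H h" and surj: "h ` carrier G = carrier H"
  shows "steinberg R H n (\<lambda>i j c. h (t i j c))"
proof -
  interpret h: group_hom G H h by (rule h)
  show ?thesis
  proof unfold_locales
    have "carrier H = h ` generate G {t i j c | i j c. i < n \<and> j < n \<and> i \<noteq> j \<and> c \<in> carrier R}"
      by (simp add: surj flip: carrier_eq_generate)
    also have "\<dots> = generate H (h ` {t i j c | i j c. i < n \<and> j < n \<and> i \<noteq> j \<and> c \<in> carrier R})"
      by (intro h.generate_img[symmetric]) auto
    also have "h ` {t i j c | i j c. i < n \<and> j < n \<and> i \<noteq> j \<and> c \<in> carrier R}
        = {h (t i j c) | i j c. i < n \<and> j < n \<and> i \<noteq> j \<and> c \<in> carrier R}"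
      by blast
    finally show "carrier H = generate H
        {h (t i j c) | i j c. i < n \<and> j < n \<and> i \<noteq> j \<and> c \<in> carrier R}" .
  qed (use n_ge in \<open>simp_all add: t_add t_commute t_chain flip: h.hom_mult\<close>)
qed

lemma E_image:
  assumes h: "group_hom G H h" and surj: "h ` carrier G = carrier H" and A: "ideal A R"
  shows "steinberg.E H n (\<lambda>i j c. h (t i j c)) A = h ` E A"
proof -
  interpret h: group_hom G H h by (rule h)
  have "h ` E A = generate H (h ` {t i j a | i j a. i < n \<and> j < n \<and> i \<noteq> j \<and> a \<in> A})"
    unfolding E_def by (intro h.generate_img[symmetric]) (auto simp: ideal_mem_carrier[OF A])
  also have "h ` {t i j a | i j a. i < n \<and> j < n \<and> i \<noteq> j \<and> a \<in> A}
      = {h (t i j a) | i j a. i < n \<and> j < n \<and> i \<noteq> j \<and> a \<in> A}"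
    by blast
  finally show ?thesis
    by (simp add: steinberg.E_def[OF steinberg_image[OF h surj]])
qed

lemma Y_image:
  assumes h: "group_hom G H h" and surj: "h ` carrier G = carrier H"
    and A: "ideal A R" and B: "ideal B R" and kl: "k < n" "l < n" "k \<noteq> l"
  shows "steinberg.Y H (\<lambda>i j c. h (t i j c)) k l A B = h ` Y k l A B"
proof -
  interpret h: group_hom G H h by (rule h)
  interpret H: steinberg R H n "\<lambda>i j c. h (t i j c)" by (rule steinberg_image[OF h surj])
  have y: "h (y k l a b) = H.y k l a b" if "a \<in> A" "b \<in> B" for a b
    using that kl by (simp add: y_def H.y_def h.commutator_img ideal_mem_carrier[OF A] ideal_mem_carrier[OF B])
  have "h ` Y k l A B = generate H (h ` {y k l a b | a b. a \<in> A \<and> b \<in> B})"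
    unfolding Y_def using kl
    by (intro h.generate_img[symmetric]) (auto simp: ideal_mem_carrier[OF A] ideal_mem_carrier[OF B])
  also have "h ` {y k l a b | a b. a \<in> A \<and> b \<in> B} = {H.y k l a b | a b. a \<in> A \<and> b \<in> B}"
    using y by (auto simp: image_iff) (metis)+
  finally show ?thesis by (simp add: H.Y_def)
qed

section \<open>Commutators of levels\<close>

abbreviation sym :: "'a set \<Rightarrow> 'a set \<Rightarrow> 'a set" where
  "sym A B \<equiv> symmetrised_product R A B"

lemma ideal_symmetrised_product:
  "ideal A R \<Longrightarrow> ideal B R \<Longrightarrow> ideal (sym A B) R"
  by (simp add: symmetrised_product_def add_ideals ideal_prod_is_ideal)

lemma mem_set_add: "p \<in> P \<Longrightarrow> q \<in> Q \<Longrightarrow> p \<oplus> q \<in> P <+> Q"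
  by (auto simp: set_add_def')

lemma mult_mem_symmetrised_product:
  assumes "ideal A R" "ideal B R" "a \<in> A" "b \<in> B"
  shows "a \<otimes> b \<in> sym A B" "b \<otimes> a \<in> sym A B"
proof -
  have P: "ideal (ideal_prod R A B) R" and Q: "ideal (ideal_prod R B A) R"
    using assms by (simp_all add: ideal_prod_is_ideal)
  have "a \<otimes> b = a \<otimes> b \<oplus> \<zero>" "b \<otimes> a = \<zero> \<oplus> b \<otimes> a"
    using assms by (simp_all add: ideal_mem_carrier)
  moreover have "\<zero> \<in> ideal_prod R A B" "\<zero> \<in> ideal_prod R B A"
    using P Q additive_subgroup.zero_closed ideal.axioms(1) by blast+
  ultimately show "a \<otimes> b \<in> sym A B" "b \<otimes> a \<in> sym A B"
    using assms mem_set_add[of "a \<otimes> b" _ \<zero>] mem_set_add[of \<zero> _ "b \<otimes> a"]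
    by (simp_all add: symmetrised_product_def ideal_prod.prod ideal_mem_carrier)
qed

lemma z_add:
  assumes "i < n" "j < n" "i \<noteq> j" "a \<in> carrier R" "b \<in> carrier R" "c \<in> carrier R"
  shows "z i j (a \<oplus> b) c = z i j a c \<otimes>\<^bsub>G\<^esub> z i j b c"
  using assms by (simp add: z_def t_add G.conjugate_mult)

lemma subgroup_K: "ideal A R \<Longrightarrow> ideal B R \<Longrightarrow> subgroup (K A B) G"
  by (intro G.mutual_commutator_subgroup ideal_E_carrier)

lemma K_commute: "ideal A R \<Longrightarrow> ideal B R \<Longrightarrow> K A B = K B A"
  by (intro G.mutual_commutator_commute ideal_E_carrier)

text \<open>\<open>t i j (a b)\<close> is the commutator of \<open>t i h a\<close> and
  \<open>t h j b\<close>. Neither is opposite to \<open>t j i c\<close>, so conjugation leaves them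
  in \<open>E A\<close> and \<open>E B\<close>.\<close>

lemma z_mult_mem_K:
  assumes ideals: "ideal A R" "ideal B R" and ij: "i < n" "j < n" "i \<noteq> j"
    and ab: "a \<in> A" "b \<in> B" and c: "c \<in> carrier R"
  shows "z i j (a \<otimes> b) c \<in> K A B"
proof -
  obtain h where h: "h < n" "h \<noteq> i" "h \<noteq> j" by (rule third_index)
  note carr = ideal_mem_carrier[OF ideals(1)] ideal_mem_carrier[OF ideals(2)]
  have "t i j (a \<otimes> b) = commutator G (t i h a) (t h j b)"
    using ij h ab t_chain[of i h j a b] by (simp add: commutator_def carr G.group_word)
  then have "z i j (a \<otimes> b) c
      = commutator G (t j h (c \<otimes> a) \<otimes>\<^bsub>G\<^esub> t i h a) (t h i (\<ominus> (b \<otimes> c)) \<otimes>\<^bsub>G\<^esub> t h j b)"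
    using ij h ab c by (simp add: z_def G.conjugate_commutator conjugate_t carr)
  moreover have "t j h (c \<otimes> a) \<otimes>\<^bsub>G\<^esub> t i h a \<in> E A" "t h i (\<ominus> (b \<otimes> c)) \<otimes>\<^bsub>G\<^esub> t h j b \<in> E B"
    using ij h ab c ideals
    by (auto intro!: subgroup.m_closed[OF ideal_subgroup_E] t_mem_E
        simp: ideal_closed[OF ideals(1)] ideal_closed[OF ideals(2)])
  ultimately show ?thesis by (simp add: G.commutator_mem_mutual_commutator)
qed

lemma Z_symmetrised_product_subset_K:
  assumes ideals: "ideal A R" "ideal B R"
  shows "Z (sym A B) \<subseteq> K A B"
  unfolding Z_def
proof (rule G.generate_subgroup_incl[OF _ subgroup_K[OF ideals]], clarify)
  fix i j x c assume ij: "i < n" "j < n" "i \<noteq> j" and x: "x \<in> sym A B" and c: "c \<in> carrier R"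
  \<comment> \<open>Stated for fresh \<open>A\<close> and \<open>B\<close>: the symmetrised product
    also contains the products in the other order, for which the ideals are exchanged and
    \<open>K_commute\<close> is used.\<close>
  have prod: "z i j x c \<in> K A B" if "x \<in> ideal_prod R A B" "ideal A R" "ideal B R" for x A B
    using that
  proof (induction x rule: ideal_prod.induct)
    case (prod a b)
    then show ?case using ij c by (intro z_mult_mem_K)
  next
    case (sum x x')
    then show ?case
      using ij c ideal_prod_in_carrier[of A B]
      by (auto simp: z_add subset_iff intro: subgroup.m_closed[OF subgroup_K])
  qed
  from x obtain p q where "p \<in> ideal_prod R A B" "q \<in> ideal_prod R B A" "x = p \<oplus> q"
    unfolding symmetrised_product_def set_add_def' by blast
  with ideals ij c prod[of p A B] prod[of q B A] show "z i j x c \<in> K A B"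
    using ideal_prod_in_carrier[of A B] ideal_prod_in_carrier[of B A] K_commute[OF ideals]
    by (auto simp: z_add subset_iff intro: subgroup.m_closed[OF subgroup_K])
qed

text \<open>Modulo \<open>Z (sym A B)\<close> the vanishing assumptions hold, so the image of
  \<open>K A B\<close> lies in the central subgroup generated by the \<open>y k l a b\<close>.
  Lifting an element of it gives the factorisation; centrality puts every commutator with
  \<open>x\<close> into \<open>Z (sym A B)\<close>.\<close>

lemma
  assumes ideals: "ideal A R" "ideal B R" and kl: "k < n" "l < n" "k \<noteq> l" and x: "x \<in> K A B"
  shows K_factor: "\<exists>u\<in>Z (sym A B). \<exists>v\<in>Y k l A B. x = u \<otimes>\<^bsub>G\<^esub> v"
    and conj_by_mem_K: "\<And>g. g \<in> carrier G \<Longrightarrow> conj_by G g x \<in> K A B"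
proof -
  define N where "N = Z (sym A B)"
  have N: "N \<lhd> G"
    unfolding N_def using ideals by (intro ideal_normal_Z ideal_symmetrised_product)
  interpret N: normal N G by (rule N)
  let ?h = "\<lambda>x. N #>\<^bsub>G\<^esub> x"
  have hom: "group_hom G (G Mod N) ?h"
    using N.factorgroup_is_group N.r_coset_hom_Mod
    by (simp add: group_hom_def group_hom_axioms_def G.is_group)
  interpret h: group_hom G "G Mod N" ?h by (rule hom)
  have surj: "?h ` carrier G = carrier (G Mod N)"
    by (simp add: carrier_FactGroup)
  interpret Q: steinberg R "G Mod N" n "\<lambda>i j c. ?h (t i j c)"
    by (rule steinberg_image[OF hom surj])
  have ker: "?h g = \<one>\<^bsub>G Mod N\<^esub> \<longleftrightarrow> g \<in> N" if "g \<in> carrier G" for g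
    using that G.coset_join1[of N g] G.coset_join2[of g N] N.subgroup_axioms by auto
  have vanish: "?h (t i j c) = \<one>\<^bsub>G Mod N\<^esub>" if "i < n" "j < n" "i \<noteq> j" "c \<in> sym A B" for i j c
    using that ideal_symmetrised_product[OF ideals]
      steinberg_ideal.t_mem_Z[OF steinberg_ideal.intro[OF steinberg_axioms]]
    by (subst ker) (auto simp: N_def ideal_mem_carrier)
  have x': "x \<in> carrier G" by (rule subgroup.mem_carrier[OF subgroup_K[OF ideals] x])
  \<comment> \<open>\<open>Q.K\<close> and \<open>Q.Y\<close> are formed in the quotient;
    \<open>E_image\<close> and \<open>Y_image\<close> identify their ingredients with images from
    \<open>G\<close>.\<close>
  have KY: "Q.K A B \<subseteq> Q.Y k l A B"
    by (rule Q.K_subset_Y[OF ideals _ _ kl]; rule vanish; simp add: mult_mem_symmetrised_product[OF ideals])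
  have "?h x \<in> Q.K A B"
    using x by (simp add: E_image[OF hom surj] ideals h.mutual_commutator_img ideal_E_carrier)
  with KY have hx: "?h x \<in> Q.Y k l A B" by blast
  then obtain v where v: "v \<in> Y k l A B" "?h x = ?h v"
    unfolding Y_image[OF hom surj ideals kl] by blast
  have v': "v \<in> carrier G"
    by (rule subgroup.mem_carrier[OF subgroup_Y[OF kl ideals] v(1)])
  have "x \<otimes>\<^bsub>G\<^esub> inv\<^bsub>G\<^esub> v \<in> N"
    using x' v v' h.H.r_inv[OF h.hom_closed[OF v']] by (subst ker[symmetric]) simp_all
  moreover have "x = (x \<otimes>\<^bsub>G\<^esub> inv\<^bsub>G\<^esub> v) \<otimes>\<^bsub>G\<^esub> v"
    using x' v' by (simp add: G.m_assoc)
  ultimately show "\<exists>u\<in>Z (sym A B). \<exists>v\<in>Y k l A B. x = u \<otimes>\<^bsub>G\<^esub> v"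
    using v unfolding N_def by blast
  show "conj_by G g x \<in> K A B" if g: "g \<in> carrier G" for g
  proof -
    have "conj_by (G Mod N) (?h g) (?h x) = ?h x"
    proof (rule Q.Y_central[OF ideals _ _ kl hx])
      show "?h g \<in> carrier (G Mod N)" using g by simp
    qed (rule vanish; simp add: mult_mem_symmetrised_product[OF ideals])+
    then have "commutator (G Mod N) (?h g) (?h x) = \<one>\<^bsub>G Mod N\<^esub>"
      using g x' h.H.commutator_eq_one_iff[of "?h g" "?h x"]
        h.H.conjugate_eq_iff[of "?h g" "?h x" "?h x"] h.hom_closed by metis
    then have "?h (commutator G g x) = \<one>\<^bsub>G Mod N\<^esub>"
      using g x' h.commutator_img[of g x] by metis
    \<comment> \<open>The commutator lies in the kernel \<open>N\<close>, which \<open>K A B\<close>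
      contains; hence the conjugate differs from \<open>x\<close> by an element of
      \<open>K A B\<close>.\<close>
    then have "commutator G g x \<in> K A B"
      using g x' ker Z_symmetrised_product_subset_K[OF ideals] by (auto simp: N_def)
    then show ?thesis
      using g x x' subgroup.m_closed[OF subgroup_K[OF ideals]] by (simp add: G.conjugate_conv_commutator)
  qed
qed

lemma normal_K:
  assumes ideals: "ideal A R" "ideal B R"
  shows "K A B \<lhd> G"
proof -
  have "conj_by G g x \<in> K A B" if "g \<in> carrier G" "x \<in> K A B" for g x
    using conj_by_mem_K[OF ideals, of 0 1 x g] that n_ge by auto
  then show ?thesis
    by (simp add: G.normal_inv_iff subgroup_K[OF ideals] conj_by_def)
qed

text \<open>A generator of \<open>Z A\<close> is a conjugate of some \<open>t i j a\<close>. The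
  conjugation can be moved to the invariant set \<open>S\<close> and to the normal subgroup
  \<open>N\<close>, so plain transvections suffice.\<close>

lemma commutator_Z_right:
  assumes N: "N \<lhd> G" and A: "ideal A R" and S: "S \<subseteq> carrier G"
    and invariant: "\<And>g s. g \<in> carrier G \<Longrightarrow> s \<in> S \<Longrightarrow> conj_by G g s \<in> S"
    and gens: "\<And>i j a s. i < n \<Longrightarrow> j < n \<Longrightarrow> i \<noteq> j \<Longrightarrow> a \<in> A \<Longrightarrow> s \<in> S \<Longrightarrow> commutator G s (t i j a) \<in> N"
    and s: "s \<in> S" and w: "w \<in> Z A"
  shows "commutator G s w \<in> N"
proof (rule G.commutator_generate_mem[OF N S _ _ _ w[unfolded Z_def]])
  show "s \<in> generate G S" using s by (rule generate.incl)
  show "{z i j a c | i j a c. i < n \<and> j < n \<and> i \<noteq> j \<and> a \<in> A \<and> c \<in> carrier R} \<subseteq> carrier G"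
    using A by (auto simp: ideal_mem_carrier)
  show "commutator G s t' \<in> N"
    if s: "s \<in> S" and t': "t' \<in> {z i j a c | i j a c. i < n \<and> j < n \<and> i \<noteq> j \<and> a \<in> A \<and> c \<in> carrier R}" for s t'
  proof -
    from t' obtain i j a c where "t' = z i j a c" "i < n" "j < n" "i \<noteq> j" "a \<in> A" "c \<in> carrier R"
      by blast
    with s S A show ?thesis
      by (auto simp: z_def G.commutator_conj_by_right ideal_mem_carrier subsetD[OF S]
          intro!: G.normal_conjugate_closed[OF N] gens invariant)
  qed
qed

lemma commutator_t_z_mem_K:
  assumes ideals: "ideal A R" "ideal B R"
    and ij: "i < n" "j < n" "i \<noteq> j" and kl: "k < n" "l < n" "k \<noteq> l"
    and ab: "a \<in> A" "b \<in> B" and c: "c \<in> carrier R"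
  shows "commutator G (t i j a) (z k l b c) \<in> K A B"
proof -
  have N: "K A B \<lhd> G" by (rule normal_K[OF ideals])
  note A_closed = ideal_closed[OF ideals(1)] and B_closed = ideal_closed[OF ideals(2)]
  interpret EA: subgroup "E A" G by (rule ideal_subgroup_E[OF ideals(1)])
  interpret EB: subgroup "E B" G by (rule ideal_subgroup_E[OF ideals(2)])
  note EE = G.commutator_mem_mutual_commutator[of _ "E A" _ "E B"]
  show ?thesis
  proof (cases "k = i \<and> l = j")
    case False
    then consider "l \<noteq> j" "k \<noteq> i" | "l = j" "k \<noteq> i" | "l \<noteq> j" "k = i" by blast
    \<comment> \<open>The conjugation hidden in \<open>z k l b c\<close> is moved to
      \<open>t i j a\<close>, to which \<open>t l k\<close> is opposite only if
      \<open>(k, l) = (i, j)\<close>.\<close>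
    then have "conj_by G (t l k (\<ominus> c)) (t i j a) \<in> E A"
      by cases (use ij kl ab c ideals in
        \<open>auto simp: conjugate_t A_closed intro!: EA.m_closed t_mem_E\<close>)
    then show ?thesis
      using kl ij ab c
      by (auto simp: z_def G.commutator_conj_by_right A_closed B_closed inv_t
          intro!: G.normal_conjugate_closed[OF N] EE t_mem_E)
  next
    case True
    obtain h where h: "h < n" "h \<noteq> i" "h \<noteq> j" by (rule third_index)
    \<comment> \<open>\<open>t_factor\<close> makes \<open>t i j b\<close> the commutator of
      \<open>t h j (-1)\<close> and \<open>t i h b\<close>. Conjugation by \<open>t j i c\<close>
      turns these into \<open>v\<close> and \<open>u\<close>, so \<open>z i j b c\<close> is the
      commutator of \<open>v\<close> and \<open>u\<close>. The inverse of \<open>v\<close> moves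
      \<open>t i j a\<close> only within \<open>E A\<close>.\<close>
    define u where "u = t j h (c \<otimes> b) \<otimes>\<^bsub>G\<^esub> t i h b"
    define v where "v = t h i c \<otimes>\<^bsub>G\<^esub> t h j (\<ominus> \<one>)"
    have u: "u \<in> E B" unfolding u_def
      using ij h ab c ideals by (auto intro!: EB.m_closed t_mem_E simp: B_closed)
    have v: "v \<in> carrier G" using ij h c by (simp add: v_def)
    have cu: "conj_by G (t j i c) (t i h b) = u"
      using ij h ab c by (simp add: u_def conjugate_t B_closed)
    have cu': "conj_by G (t j i c) (t i h (\<ominus> b)) = inv\<^bsub>G\<^esub> u"
      using ij h c ab by (simp add: G.conjugate_inv B_closed flip: inv_t cu)
    have cv: "conj_by G (t j i c) (t h j (\<ominus> \<one>)) = v"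
      using ij h c by (simp add: v_def conjugate_t l_minus)
    have "z i j b c = conj_by G v u \<otimes>\<^bsub>G\<^esub> inv\<^bsub>G\<^esub> u"
      using ij h ab c
      by (simp add: z_def t_factor[of i j h b] G.conjugate_mult B_closed cu'
          G.conjugate_conjugate[of "t j i c" "t h j (\<ominus> \<one>)"] cu cv)
    moreover have "commutator G (t i j a) (conj_by G v u) \<in> K A B"
    proof -
      have "inv\<^bsub>G\<^esub> v = t h j \<one> \<otimes>\<^bsub>G\<^esub> t h i (\<ominus> c)"
        using ij h c by (simp add: v_def G.inv_mult_group inv_t)
      then have "conj_by G (inv\<^bsub>G\<^esub> v) (t i j a) = t h j (\<ominus> c \<otimes> a) \<otimes>\<^bsub>G\<^esub> t i j a"
        using ij h ab c by (simp add: G.conjugate_by_mult conjugate_t G.conjugate_mult A_closed)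
      moreover have "\<dots> \<in> E A"
        using ij h ab c ideals by (auto intro!: EA.m_closed t_mem_E simp: A_closed)
      ultimately show ?thesis
        using v u ij ab
        by (auto simp: G.commutator_conj_by_right A_closed EB.mem_carrier
            intro!: G.normal_conjugate_closed[OF N] EE)
    qed
    moreover have "commutator G (t i j a) (inv\<^bsub>G\<^esub> u) \<in> K A B"
      using ij ab u by (intro EE t_mem_E) auto
    ultimately show ?thesis
      using True ij ab u v
      by (auto simp: G.commutator_mult_right A_closed EB.mem_carrier
          intro!: subgroup.m_closed[OF subgroup_K[OF ideals]] G.normal_conjugate_closed[OF N])
  qed
qed

text \<open>The second argument is extended from generators \<open>z\<close> to \<open>Z B\<close>
  first. Then \<open>commutator_Z_right\<close> with the normal subgroup \<open>Z B\<close> as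
  \<open>S\<close> extends the first argument from transvections to \<open>Z A\<close>.\<close>

lemma commutator_Z_Z_mem_K:
  assumes ideals: "ideal A R" "ideal B R" and xy: "x \<in> Z A" "w \<in> Z B"
  shows "commutator G x w \<in> K A B"
proof -
  have N: "K A B \<lhd> G" by (rule normal_K[OF ideals])
  have sub: "subgroup (K A B) G" by (rule subgroup_K[OF ideals])
  note carr = ideal_mem_carrier[OF ideals(1)] ideal_mem_carrier[OF ideals(2)]
  have "commutator G s (t i j a) \<in> K A B"
    if ij: "i < n" "j < n" "i \<noteq> j" and a: "a \<in> A" and s: "s \<in> Z B" for i j a s
  proof (rule G.commutator_swap_mem[OF sub])
    show "commutator G (t i j a) s \<in> K A B"
    proof (rule G.commutator_generate_mem[OF N _ _ _ _ s[unfolded Z_def]])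
      show "t i j a \<in> generate G {t i j a}" by (simp add: generate.incl)
    qed (use ij a carr in \<open>auto intro: commutator_t_z_mem_K[OF ideals]\<close>)
  qed (use ij a s ideal_Z_carrier[OF ideals(2)] carr in auto)
  then have "commutator G w x \<in> K A B"
    using commutator_Z_right[OF N ideals(1) ideal_Z_carrier[OF ideals(2)] _ _ xy(2,1)]
      G.normal_conjugate_closed[OF ideal_normal_Z[OF ideals(2)]] by blast
  then show ?thesis
    using xy ideal_Z_carrier[OF ideals(1)] ideal_Z_carrier[OF ideals(2)]
    by (intro G.commutator_swap_mem[OF sub, of w x]) auto
qed

section \<open>Commutators of commutators, by means of disjoint index pairs\<close>

lemma disjoint_indices:
  obtains k l where "k < n" "l < n" "k \<noteq> l" "k \<noteq> i" "k \<noteq> j" "l \<noteq> i" "l \<noteq> j"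
proof -
  obtain k where k: "k < n" "k \<noteq> i" "k \<noteq> j" by (rule third_index)
  have "\<exists>l. l < 4 \<and> l \<noteq> i \<and> l \<noteq> j \<and> l \<noteq> k" by presburger
  then obtain l where "l < 4" "l \<noteq> i" "l \<noteq> j" "l \<noteq> k" by blast
  with k n_ge show ?thesis by (intro that[of k l]) auto
qed

lemma commutator_y_t:
  assumes "i < n" "j < n" "i \<noteq> j" "k < n" "l < n" "k \<noteq> l" "k \<noteq> i" "k \<noteq> j" "l \<noteq> i" "l \<noteq> j"
    and "a \<in> carrier R" "b \<in> carrier R" "c \<in> carrier R"
  shows "commutator G (y k l a b) (t i j c) = \<one>\<^bsub>G\<^esub>"
proof -
  have "conj_by G (t i j c) (y k l a b) = y k l a b"
    using assms by (simp add: y_def G.conjugate_commutator conjugate_t)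
  with assms show ?thesis
    by (simp add: G.commutator_conv_conjugate G.conjugate_inv)
qed

text \<open>By \<open>commutator_Z_right\<close> the second argument may be taken as
  \<open>t i j c\<close>. Four indices leave room for a pair \<open>(k, l)\<close> disjoint from
  \<open>(i, j)\<close>; in the factorisation along that pair the \<open>Y\<close> part commutes
  with \<open>t i j c\<close>, and the \<open>Z\<close> part falls under
  \<open>commutator_Z_Z_mem_K\<close>.\<close>

lemma commutator_K_Z_mem_K:
  assumes ideals: "ideal A R" "ideal B R" "ideal C R" and xy: "x \<in> K A B" "w \<in> Z C"
  shows "commutator G x w \<in> K (sym A B) C"
proof (rule commutator_Z_right[OF _ ideals(3) _ _ _ xy])
  have AB: "ideal (sym A B) R" using ideals by (intro ideal_symmetrised_product)
  show N: "K (sym A B) C \<lhd> G" using AB ideals by (intro normal_K)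
  show KG: "K A B \<subseteq> carrier G" by (intro subgroup.subset subgroup_K ideals)
  show "conj_by G g s \<in> K A B" if "g \<in> carrier G" "s \<in> K A B" for g s
    using that ideals by (intro G.normal_conjugate_closed normal_K)
  show "commutator G s (t i j c) \<in> K (sym A B) C"
    if ij: "i < n" "j < n" "i \<noteq> j" and c: "c \<in> C" and s: "s \<in> K A B" for i j c s
  proof -
    obtain k l where kl: "k < n" "l < n" "k \<noteq> l" "k \<noteq> i" "k \<noteq> j" "l \<noteq> i" "l \<noteq> j"
      by (rule disjoint_indices)
    from K_factor[OF ideals(1,2) kl(1-3) s] obtain u v
      where u: "u \<in> Z (sym A B)" and v: "v \<in> Y k l A B" and s: "s = u \<otimes>\<^bsub>G\<^esub> v" by blast
    have carr: "u \<in> carrier G" "v \<in> carrier G" "t i j c \<in> carrier G"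
      using u v ij c ideal_Z_carrier[OF AB] subgroup.subset[OF subgroup_Y[OF kl(1-3) ideals(1,2)]]
        ideal_mem_carrier[OF ideals(3)] by auto
    have "commutator G v (t i j c) \<in> {\<one>\<^bsub>G\<^esub>}"
    proof (rule G.commutator_generate_mem[OF G.one_normal _ _ _ v[unfolded Y_def]])
      show "t i j c \<in> generate G {t i j c}" by (simp add: generate.incl)
    qed (use ij kl c ideals in \<open>auto simp: commutator_y_t ideal_mem_carrier\<close>)
    moreover have "commutator G u (t i j c) \<in> K (sym A B) C"
      using u ij c ideal_E_subset_Z[OF ideals(3)]
      by (intro commutator_Z_Z_mem_K AB ideals) (auto intro: t_mem_E)
    ultimately show ?thesis
      using carr subgroup.mem_carrier[OF normal_imp_subgroup[OF N]] by (simp add: s G.commutator_mult_left)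
  qed
qed

lemma Y_subset_K:
  assumes "ideal A R" "ideal B R" "k < n" "l < n" "k \<noteq> l"
  shows "Y k l A B \<subseteq> K A B"
  unfolding Y_def y_def using assms
  by (intro G.generate_subgroup_incl subgroup_K)
    (auto intro!: G.commutator_mem_mutual_commutator t_mem_E)

text \<open>With the disjoint pairs \<open>(0, 1)\<close> and \<open>(2, 3)\<close> for the two
  factorisations, the two \<open>Y\<close> parts commute. Every other contribution has an argument
  in \<open>Z (sym A B)\<close> or \<open>Z (sym C D)\<close> and is covered by the previous
  case.\<close>

lemma commutator_K_K_mem_K:
  assumes ideals: "ideal A R" "ideal B R" "ideal C R" "ideal D R"
    and x: "x \<in> K A B" and w: "w \<in> K C D"
  shows "commutator G x w \<in> K (sym A B) (sym C D)"
proof -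
  have AB: "ideal (sym A B) R" and CD: "ideal (sym C D) R"
    using ideals by (simp_all add: ideal_symmetrised_product)
  have N: "K (sym A B) (sym C D) \<lhd> G" by (intro normal_K AB CD)
  have sub: "subgroup (K (sym A B) (sym C D)) G" by (intro subgroup_K AB CD)
  have ind: "0 < n" "1 < n" "2 < n" "3 < n" using n_ge by auto
  obtain u v where u: "u \<in> Z (sym A B)" and v: "v \<in> Y 0 1 A B" and x_eq: "x = u \<otimes>\<^bsub>G\<^esub> v"
    using K_factor[OF ideals(1,2) ind(1,2) _ x] by auto
  obtain p q where p: "p \<in> Z (sym C D)" and q: "q \<in> Y 2 3 C D" and w_eq: "w = p \<otimes>\<^bsub>G\<^esub> q"
    using K_factor[OF ideals(3,4) ind(3,4) _ w] by auto
  have carr: "u \<in> carrier G" "v \<in> carrier G" "p \<in> carrier G" "q \<in> carrier G"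
      "x \<in> carrier G" "w \<in> carrier G"
    using u v p q x w ideal_Z_carrier[OF AB] ideal_Z_carrier[OF CD]
      subgroup.subset[OF subgroup_K[OF ideals(1,2)]] subgroup.subset[OF subgroup_K[OF ideals(3,4)]]
      Y_subset_K[OF ideals(1,2) ind(1,2)] Y_subset_K[OF ideals(3,4) ind(3,4)] by auto
  have "commutator G u w \<in> K (sym A B) (sym C D)"
    using u w carr commutator_K_Z_mem_K[OF ideals(3,4) AB w u] K_commute[OF AB CD]
    by (intro G.commutator_swap_mem[OF sub, of w u]) auto
  moreover have "commutator G v p \<in> K (sym A B) (sym C D)"
    using v p Y_subset_K[OF ideals(1,2) ind(1,2)] by (intro commutator_K_Z_mem_K ideals CD) auto
  moreover have "commutator G v q \<in> {\<one>\<^bsub>G\<^esub>}"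
  proof (rule G.commutator_generate_mem[OF G.one_normal _ _ _ v[unfolded Y_def] q[unfolded Y_def]])
    fix s r assume "s \<in> {y 0 1 a b | a b. a \<in> A \<and> b \<in> B}" "r \<in> {y 2 3 a b | a b. a \<in> C \<and> b \<in> D}"
    then obtain a b c d where "s = y 0 1 a b" "a \<in> A" "b \<in> B" "r = y 2 3 c d" "c \<in> C" "d \<in> D"
      by blast
    \<comment> \<open>Only the second elementary commutator is expanded: each of its letters
      \<open>t 2 3\<close> and \<open>t 3 2\<close> commutes with \<open>y 0 1 a b\<close>.\<close>
    then show "commutator G s r \<in> {\<one>\<^bsub>G\<^esub>}"
      using ind ideals
      by (simp add: y_def[of 2] commutator_def[of _ "t 2 3 c"] G.commutator_mult_right inv_t
          commutator_y_t ideal_mem_carrier)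
  qed (use ind ideals in \<open>auto simp: ideal_mem_carrier\<close>)
  ultimately show ?thesis
    using carr
    by (simp add: x_eq G.commutator_mult_left)
      (simp add: w_eq G.commutator_mult_right subgroup.mem_carrier[OF sub] subgroup.m_closed[OF sub]
        G.normal_conjugate_closed[OF N])
qed

section \<open>Induction over the bracketing\<close>

lemma E_symmetrised_product_subset_K:
  "ideal A R \<Longrightarrow> ideal B R \<Longrightarrow> E (sym A B) \<subseteq> K A B"
  using ideal_E_subset_Z[OF ideal_symmetrised_product] Z_symmetrised_product_subset_K by blast

text \<open>The induction invariant. A bracket of two or more factors is recorded as
  \<open>K A B\<close> itself, since it is only known to contain \<open>E (sym A B)\<close>; the
  replacement by \<open>E J\<close> becomes possible inside a further commutator.\<close>

definition has_level :: "'g set \<Rightarrow> 'a set \<Rightarrow> bool" where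
  "has_level F J \<longleftrightarrow> ideal J R \<and>
    (F = E J \<or> (\<exists>A B. ideal A R \<and> ideal B R \<and> F = K A B \<and> J = sym A B))"

lemma has_level_carrier: "has_level F J \<Longrightarrow> F \<subseteq> carrier G"
  unfolding has_level_def using ideal_E_carrier subgroup_K subgroup.subset by metis

lemma E_subset_if_has_level: "has_level F J \<Longrightarrow> E J \<subseteq> F"
  unfolding has_level_def using E_symmetrised_product_subset_K by blast

text \<open>One inclusion is monotonicity. The other splits by the form of the two arguments, and
  each combination with a \<open>K\<close> is one of the commutator computations above, up to a
  swap.\<close>

lemma mutual_commutator_has_level:
  assumes F: "has_level F J" and H: "has_level H L"
  shows "mutual_commutator G F H = K J L"
proof
  have ideals: "ideal J R" "ideal L R" using F H by (auto simp: has_level_def)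
  show "K J L \<subseteq> mutual_commutator G F H"
    using F H by (intro G.mutual_commutator_mono has_level_carrier E_subset_if_has_level)
  show "mutual_commutator G F H \<subseteq> K J L"
  proof (rule G.mutual_commutator_subset[OF subgroup_K[OF ideals]])
    fix f h assume fh: "f \<in> F" "h \<in> H"
    have carr: "f \<in> carrier G" "h \<in> carrier G"
      using fh F H has_level_carrier by blast+
    consider "F = E J" "H = E L"
      | A B where "ideal A R" "ideal B R" "F = K A B" "J = sym A B" "H = E L"
      | C D where "ideal C R" "ideal D R" "H = K C D" "L = sym C D" "F = E J"
      | A B C D where "ideal A R" "ideal B R" "F = K A B" "J = sym A B"
          "ideal C R" "ideal D R" "H = K C D" "L = sym C D"
      using F H unfolding has_level_def by metis
    then show "commutator G f h \<in> K J L"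
    proof cases
      case 1
      then show ?thesis using fh by (simp add: G.commutator_mem_mutual_commutator)
    next
      case 2
      then show ?thesis
        using fh ideals ideal_E_subset_Z[OF ideals(2)] by (auto intro: commutator_K_Z_mem_K)
    next
      case 3
      then have "commutator G h f \<in> K L J"
        using fh ideals ideal_E_subset_Z[OF ideals(1)] by (auto intro: commutator_K_Z_mem_K)
      then show ?thesis
        using carr K_commute[OF ideals]
        by (intro G.commutator_swap_mem[OF subgroup_K[OF ideals], of h f]) auto
    next
      case 4
      then show ?thesis using fh by (auto intro: commutator_K_K_mem_K)
    qed
  qed
qed

lemma bracketed_has_level:
  "(\<And>j. k \<le> j \<Longrightarrow> j < k + num_factors b \<Longrightarrow> ideal (I j) R) \<Longrightarrow>
    has_level (bracketed (mutual_commutator G) b (\<lambda>j. E (I j)) k)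
      (bracketed (symmetrised_product R) b I k)"
proof (induction b arbitrary: k)
  case Single
  then show ?case by (simp add: has_level_def)
next
  case (Bracket l r)
  let ?J = "bracketed (symmetrised_product R) l I k"
  let ?L = "bracketed (symmetrised_product R) r I (k + num_factors l)"
  have levels: "has_level (bracketed (mutual_commutator G) l (\<lambda>j. E (I j)) k) ?J"
    "has_level (bracketed (mutual_commutator G) r (\<lambda>j. E (I j)) (k + num_factors l)) ?L"
    by (intro Bracket; simp)+
  then have "ideal ?J R" "ideal ?L R" by (simp_all add: has_level_def)
  then show ?case
    using mutual_commutator_has_level[OF levels]
    by (auto simp: has_level_def ideal_symmetrised_product)
qed

lemma bracketed_mutual_commutator:
  assumes "\<And>j. k \<le> j \<Longrightarrow> j < k + num_factors (Bracket l r) \<Longrightarrow> ideal (I j) R"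
  shows "bracketed (mutual_commutator G) (Bracket l r) (\<lambda>j. E (I j)) k =
    K (bracketed (symmetrised_product R) l I k)
      (bracketed (symmetrised_product R) r I (k + num_factors l))"
  unfolding bracketed.simps using assms
  by (intro mutual_commutator_has_level bracketed_has_level) auto

end

section \<open>Transvections\<close>

context ring
begin

section \<open>The monoid of square matrices\<close>

lemma finsum_swap:
  assumes "finite A" "finite B" "\<And>i j. i \<in> A \<Longrightarrow> j \<in> B \<Longrightarrow> f i j \<in> carrier R"
  shows "(\<Oplus>i\<in>A. \<Oplus>j\<in>B. f i j) = (\<Oplus>j\<in>B. \<Oplus>i\<in>A. f i j)"
  using assms(1,3)
proof (induction A rule: finite_induct)
  case empty
  then show ?case by simp
next
  case (insert x A)
  then have "(\<Oplus>j\<in>B. \<Oplus>i\<in>insert x A. f i j) = (\<Oplus>j\<in>B. f x j \<oplus> (\<Oplus>i\<in>A. f i j))"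
    by (intro finsum_cong') (auto simp: Pi_def)
  also have "\<dots> = (\<Oplus>j\<in>B. f x j) \<oplus> (\<Oplus>j\<in>B. \<Oplus>i\<in>A. f i j)"
    using insert by (intro finsum_addf) (auto simp: Pi_def)
  finally show ?case
    using insert by (simp add: Pi_def)
qed

lemma matrix_carrier_iff:
  "A \<in> carrier (matrix_monoid R n) \<longleftrightarrow>
    A \<in> carrier_mat n n \<and> (\<forall>i<n. \<forall>j<n. A $$ (i, j) \<in> carrier R)"
  by (auto simp: matrix_monoid_def dest!: elements_matD intro: subsetD[OF _ elements_matI])

lemma matrix_mult:
  "A \<otimes>\<^bsub>matrix_monoid R n\<^esub> B = mat n n (\<lambda>(i, j). \<Oplus>k\<in>{..<n}. A $$ (i, k) \<otimes> B $$ (k, j))"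
  by (simp add: matrix_monoid_def)

lemma matrix_one: "\<one>\<^bsub>matrix_monoid R n\<^esub> = mat n n (\<lambda>(i, j). if i = j then \<one> else \<zero>)"
  by (simp add: matrix_monoid_def)

lemma finsum_delta:
  fixes n :: nat
  assumes "i < n" "\<And>k. k < n \<Longrightarrow> f k \<in> carrier R"
  shows "(\<Oplus>k\<in>{..<n}. if k = i then f k else \<zero>) = f i"
proof -
  have "(\<Oplus>k\<in>{..<n}. if k = i then f k else \<zero>) = (\<Oplus>k\<in>{..<n}. if i = k then f k else \<zero>)"
    using assms by (intro finsum_cong') auto
  then show ?thesis
    using assms finsum_singleton[of i "{..<n}" f] by auto
qed

lemma matrix_mult_assoc:
  assumes "A \<in> carrier (matrix_monoid R n)" "B \<in> carrier (matrix_monoid R n)"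
    "C \<in> carrier (matrix_monoid R n)"
  shows "A \<otimes>\<^bsub>matrix_monoid R n\<^esub> B \<otimes>\<^bsub>matrix_monoid R n\<^esub> C
    = A \<otimes>\<^bsub>matrix_monoid R n\<^esub> (B \<otimes>\<^bsub>matrix_monoid R n\<^esub> C)"
proof (rule eq_matI)
  fix i j assume "i < dim_row (A \<otimes>\<^bsub>matrix_monoid R n\<^esub> (B \<otimes>\<^bsub>matrix_monoid R n\<^esub> C))"
    "j < dim_col (A \<otimes>\<^bsub>matrix_monoid R n\<^esub> (B \<otimes>\<^bsub>matrix_monoid R n\<^esub> C))"
  then have ij: "i < n" "j < n" by (simp_all add: matrix_mult)
  have carr: "\<And>i j. i < n \<Longrightarrow> j < n \<Longrightarrow> A $$ (i, j) \<in> carrier R"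
    "\<And>i j. i < n \<Longrightarrow> j < n \<Longrightarrow> B $$ (i, j) \<in> carrier R"
    "\<And>i j. i < n \<Longrightarrow> j < n \<Longrightarrow> C $$ (i, j) \<in> carrier R"
    using assms by (auto simp: matrix_carrier_iff)
  have "(\<Oplus>k\<in>{..<n}. (\<Oplus>l\<in>{..<n}. A $$ (i, l) \<otimes> B $$ (l, k)) \<otimes> C $$ (k, j))
      = (\<Oplus>k\<in>{..<n}. \<Oplus>l\<in>{..<n}. A $$ (i, l) \<otimes> B $$ (l, k) \<otimes> C $$ (k, j))"
    using ij carr by (intro finsum_cong' finsum_ldistr) (auto simp: Pi_def)
  also have "\<dots> = (\<Oplus>l\<in>{..<n}. \<Oplus>k\<in>{..<n}. A $$ (i, l) \<otimes> B $$ (l, k) \<otimes> C $$ (k, j))"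
    using ij carr by (intro finsum_swap) auto
  also have "\<dots> = (\<Oplus>l\<in>{..<n}. \<Oplus>k\<in>{..<n}. A $$ (i, l) \<otimes> (B $$ (l, k) \<otimes> C $$ (k, j)))"
    using ij carr by (intro finsum_cong') (auto simp: Pi_def m_assoc)
  also have "\<dots> = (\<Oplus>l\<in>{..<n}. A $$ (i, l) \<otimes> (\<Oplus>k\<in>{..<n}. B $$ (l, k) \<otimes> C $$ (k, j)))"
    using ij carr by (intro finsum_cong' finsum_rdistr[symmetric]) (auto simp: Pi_def)
  finally have "(\<Oplus>k\<in>{..<n}. (\<Oplus>l\<in>{..<n}. A $$ (i, l) \<otimes> B $$ (l, k)) \<otimes> C $$ (k, j))
      = (\<Oplus>l\<in>{..<n}. A $$ (i, l) \<otimes> (\<Oplus>k\<in>{..<n}. B $$ (l, k) \<otimes> C $$ (k, j)))" .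
  moreover have "(A \<otimes>\<^bsub>matrix_monoid R n\<^esub> B \<otimes>\<^bsub>matrix_monoid R n\<^esub> C) $$ (i, j)
      = (\<Oplus>k\<in>{..<n}. (\<Oplus>l\<in>{..<n}. A $$ (i, l) \<otimes> B $$ (l, k)) \<otimes> C $$ (k, j))"
    using ij carr by (simp add: matrix_mult) (intro finsum_cong'; auto simp: Pi_def)
  moreover have "(A \<otimes>\<^bsub>matrix_monoid R n\<^esub> (B \<otimes>\<^bsub>matrix_monoid R n\<^esub> C)) $$ (i, j)
      = (\<Oplus>l\<in>{..<n}. A $$ (i, l) \<otimes> (\<Oplus>k\<in>{..<n}. B $$ (l, k) \<otimes> C $$ (k, j)))"
    using ij carr by (simp add: matrix_mult) (intro finsum_cong'; auto simp: Pi_def)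
  ultimately show "(A \<otimes>\<^bsub>matrix_monoid R n\<^esub> B \<otimes>\<^bsub>matrix_monoid R n\<^esub> C) $$ (i, j)
      = (A \<otimes>\<^bsub>matrix_monoid R n\<^esub> (B \<otimes>\<^bsub>matrix_monoid R n\<^esub> C)) $$ (i, j)" by simp
qed (simp_all add: matrix_mult)

lemma matrix_monoid: "monoid (matrix_monoid R n)"
proof (rule monoidI)
  fix A B assume "A \<in> carrier (matrix_monoid R n)" "B \<in> carrier (matrix_monoid R n)"
  then show "A \<otimes>\<^bsub>matrix_monoid R n\<^esub> B \<in> carrier (matrix_monoid R n)"
    by (auto simp: matrix_carrier_iff matrix_mult intro!: finsum_closed)
next
  fix A assume A: "A \<in> carrier (matrix_monoid R n)"
  show "\<one>\<^bsub>matrix_monoid R n\<^esub> \<otimes>\<^bsub>matrix_monoid R n\<^esub> A = A"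
  proof (rule eq_matI)
    fix i j assume "i < dim_row A" "j < dim_col A"
    then have ij: "i < n" "j < n" using A by (auto simp: matrix_carrier_iff)
    then have "(\<one>\<^bsub>matrix_monoid R n\<^esub> \<otimes>\<^bsub>matrix_monoid R n\<^esub> A) $$ (i, j)
        = (\<Oplus>k\<in>{..<n}. if k = i then A $$ (k, j) else \<zero>)"
      using A by (simp add: matrix_mult matrix_one matrix_carrier_iff)
        (intro finsum_cong'; auto simp: Pi_def)
    also have "\<dots> = A $$ (i, j)"
      using A ij by (subst finsum_delta) (auto simp: matrix_carrier_iff)
    finally show "(\<one>\<^bsub>matrix_monoid R n\<^esub> \<otimes>\<^bsub>matrix_monoid R n\<^esub> A) $$ (i, j) = A $$ (i, j)" .
  qed (use A in \<open>auto simp: matrix_mult matrix_carrier_iff\<close>)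
  show "A \<otimes>\<^bsub>matrix_monoid R n\<^esub> \<one>\<^bsub>matrix_monoid R n\<^esub> = A"
  proof (rule eq_matI)
    fix i j assume "i < dim_row A" "j < dim_col A"
    then have ij: "i < n" "j < n" using A by (auto simp: matrix_carrier_iff)
    then have "(A \<otimes>\<^bsub>matrix_monoid R n\<^esub> \<one>\<^bsub>matrix_monoid R n\<^esub>) $$ (i, j)
        = (\<Oplus>k\<in>{..<n}. if k = j then A $$ (i, k) else \<zero>)"
      using A by (simp add: matrix_mult matrix_one matrix_carrier_iff)
        (intro finsum_cong'; auto simp: Pi_def)
    also have "\<dots> = A $$ (i, j)"
      using A ij by (subst finsum_delta) (auto simp: matrix_carrier_iff)
    finally show "(A \<otimes>\<^bsub>matrix_monoid R n\<^esub> \<one>\<^bsub>matrix_monoid R n\<^esub>) $$ (i, j) = A $$ (i, j)" .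
  qed (use A in \<open>auto simp: matrix_mult matrix_carrier_iff\<close>)
qed (auto simp: matrix_mult_assoc matrix_carrier_iff matrix_one)

lemma group_GL: "group (GL R n)"
  unfolding GL_def by (rule monoid.units_group[OF matrix_monoid])

section \<open>Steinberg relations for transvections\<close>

lemma transvection_closed:
  "c \<in> carrier R \<Longrightarrow> transvection R n i j c \<in> carrier (matrix_monoid R n)"
  by (auto simp: matrix_carrier_iff transvection_def)

text \<open>Left multiplication is a row operation, which removes the sums and reduces the Steinberg
  relations to comparisons of entries.\<close>

lemma transvection_mult:
  assumes i: "i < n" and j: "j < n" and c: "c \<in> carrier R" and A: "A \<in> carrier (matrix_monoid R n)"
  shows "transvection R n i j c \<otimes>\<^bsub>matrix_monoid R n\<^esub> A
    = mat n n (\<lambda>(k, l). A $$ (k, l) \<oplus> (if k = i then c \<otimes> A $$ (j, l) else \<zero>))"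
proof (rule eq_matI)
  fix k l assume "k < dim_row (mat n n (\<lambda>(k, l). A $$ (k, l) \<oplus> (if k = i then c \<otimes> A $$ (j, l) else \<zero>)))"
    "l < dim_col (mat n n (\<lambda>(k, l). A $$ (k, l) \<oplus> (if k = i then c \<otimes> A $$ (j, l) else \<zero>)))"
  then have kl: "k < n" "l < n" by simp_all
  have carr: "\<And>i j. i < n \<Longrightarrow> j < n \<Longrightarrow> A $$ (i, j) \<in> carrier R"
    using A by (auto simp: matrix_carrier_iff)
  have "(transvection R n i j c \<otimes>\<^bsub>matrix_monoid R n\<^esub> A) $$ (k, l)
      = (\<Oplus>p\<in>{..<n}. (if p = k then A $$ (p, l) else \<zero>)
          \<oplus> (if p = j then if k = i then c \<otimes> A $$ (p, l) else \<zero> else \<zero>))"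
  proof -
    have "(transvection R n i j c \<otimes>\<^bsub>matrix_monoid R n\<^esub> A) $$ (k, l)
        = (\<Oplus>p\<in>{..<n}. transvection R n i j c $$ (k, p) \<otimes> A $$ (p, l))"
      using kl by (simp add: matrix_mult)
    also have "\<dots> = (\<Oplus>p\<in>{..<n}. (if p = k then A $$ (p, l) else \<zero>)
        \<oplus> (if p = j then if k = i then c \<otimes> A $$ (p, l) else \<zero> else \<zero>))"
      using kl carr c by (intro finsum_cong') (auto simp: transvection_def l_distr)
    finally show ?thesis .
  qed
  also have "\<dots> = (\<Oplus>p\<in>{..<n}. if p = k then A $$ (p, l) else \<zero>)
      \<oplus> (\<Oplus>p\<in>{..<n}. if p = j then if k = i then c \<otimes> A $$ (p, l) else \<zero> else \<zero>)"
    using kl carr c by (intro finsum_addf) (auto simp: Pi_def)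
  also have "\<dots> = A $$ (k, l) \<oplus> (if k = i then c \<otimes> A $$ (j, l) else \<zero>)"
    using kl carr c j by (subst (1 2) finsum_delta) auto
  finally show "(transvection R n i j c \<otimes>\<^bsub>matrix_monoid R n\<^esub> A) $$ (k, l)
      = mat n n (\<lambda>(k, l). A $$ (k, l) \<oplus> (if k = i then c \<otimes> A $$ (j, l) else \<zero>)) $$ (k, l)"
    using kl by simp
qed (simp_all add: matrix_mult)

lemma transvection_zero: "transvection R n i j \<zero> = \<one>\<^bsub>matrix_monoid R n\<^esub>"
  by (rule eq_matI) (auto simp: transvection_def matrix_one)

lemma transvection_add:
  assumes "i < n" "j < n" "i \<noteq> j" "c \<in> carrier R" "d \<in> carrier R"
  shows "transvection R n i j (c \<oplus> d) = transvection R n i j c \<otimes>\<^bsub>matrix_monoid R n\<^esub> transvection R n i j d"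
  unfolding transvection_mult[OF assms(1,2,4) transvection_closed[OF assms(5)]]
  using assms by (intro eq_matI) (auto simp: transvection_def a_ac)

lemma transvection_commute:
  assumes "i < n" "j < n" "i \<noteq> j" "k < n" "l < n" "k \<noteq> l" "j \<noteq> k" "i \<noteq> l" "c \<in> carrier R" "d \<in> carrier R"
  shows "transvection R n i j c \<otimes>\<^bsub>matrix_monoid R n\<^esub> transvection R n k l d
    = transvection R n k l d \<otimes>\<^bsub>matrix_monoid R n\<^esub> transvection R n i j c"
  using assms
  by (simp only: transvection_mult transvection_closed)
    (intro eq_matI; auto simp: transvection_def a_ac)

lemma transvection_chain:
  assumes "i < n" "j < n" "k < n" "i \<noteq> j" "j \<noteq> k" "i \<noteq> k" "c \<in> carrier R" "d \<in> carrier R"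
  shows "transvection R n i j c \<otimes>\<^bsub>matrix_monoid R n\<^esub> transvection R n j k d
    = transvection R n i k (c \<otimes> d) \<otimes>\<^bsub>matrix_monoid R n\<^esub> transvection R n j k d
        \<otimes>\<^bsub>matrix_monoid R n\<^esub> transvection R n i j c"
proof -
  \<comment> \<open>Membership of this inner product lets the row operation apply to the
    right-nested form of the triple product.\<close>
  have "transvection R n j k d \<otimes>\<^bsub>matrix_monoid R n\<^esub> transvection R n i j c
      \<in> carrier (matrix_monoid R n)"
    using assms by (intro monoid.m_closed[OF matrix_monoid] transvection_closed)
  then have "transvection R n i k (c \<otimes> d) \<otimes>\<^bsub>matrix_monoid R n\<^esub>
      (transvection R n j k d \<otimes>\<^bsub>matrix_monoid R n\<^esub> transvection R n i j c)
    = transvection R n i j c \<otimes>\<^bsub>matrix_monoid R n\<^esub> transvection R n j k d"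
    using assms
    by (simp only: transvection_mult transvection_closed m_closed)
      (intro eq_matI; auto simp: transvection_def a_ac r_distr)
  then show ?thesis
    using assms by (simp add: matrix_mult_assoc transvection_closed)
qed

lemma transvection_GL:
  assumes "i < n" "j < n" "i \<noteq> j" "c \<in> carrier R"
  shows "transvection R n i j c \<in> carrier (GL R n)"
proof -
  have "transvection R n i j (\<ominus> c) \<otimes>\<^bsub>matrix_monoid R n\<^esub> transvection R n i j c = \<one>\<^bsub>matrix_monoid R n\<^esub>"
    "transvection R n i j c \<otimes>\<^bsub>matrix_monoid R n\<^esub> transvection R n i j (\<ominus> c) = \<one>\<^bsub>matrix_monoid R n\<^esub>"
    using assms by (simp_all add: l_neg r_neg transvection_zero flip: transvection_add)
  then show ?thesis
    using assms transvection_closed unfolding GL_def units_of_carrier Units_def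
    by (auto intro!: bexI[of _ "transvection R n i j (\<ominus> c)"])
qed

text \<open>The restriction of the carrier to the absolute elementary subgroup supplies the
  generation axiom.\<close>

lemma steinberg_transvection:
  assumes "n \<ge> 4"
  shows "steinberg R ((GL R n)\<lparr>carrier := elementary_subgroup R n (carrier R)\<rparr>) n (transvection R n)"
proof -
  interpret GL: group "GL R n" by (rule group_GL)
  let ?T = "{transvection R n i j c | i j c. i < n \<and> j < n \<and> i \<noteq> j \<and> c \<in> carrier R}"
  have T: "?T \<subseteq> carrier (GL R n)" by (auto simp: transvection_GL)
  have sub: "subgroup (elementary_subgroup R n (carrier R)) (GL R n)"
    unfolding elementary_subgroup_def by (rule GL.generate_is_subgroup[OF T])
  have mem: "?T \<subseteq> elementary_subgroup R n (carrier R)"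
    unfolding elementary_subgroup_def by (auto intro: generate.incl)
  interpret E: group "(GL R n)\<lparr>carrier := elementary_subgroup R n (carrier R)\<rparr>"
    by (rule GL.subgroup_imp_group[OF sub])
  have mult: "monoid.mult (GL R n) = monoid.mult (matrix_monoid R n)"
    by (simp add: GL_def units_of_mult)
  show ?thesis
  proof unfold_locales
    show "carrier ((GL R n)\<lparr>carrier := elementary_subgroup R n (carrier R)\<rparr>)
        = generate ((GL R n)\<lparr>carrier := elementary_subgroup R n (carrier R)\<rparr>) ?T"
      using GL.generate_consistent[OF mem sub] by (simp add: elementary_subgroup_def)
  qed (use assms mem in
      \<open>auto simp: mult transvection_add transvection_commute transvection_chain\<close>)
qed

end

section \<open>Transfer from the elementary subgroup to the general linear group\<close>

theorem theorem1:
  fixes R :: "('a, 'r) ring_scheme"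
    and n m s :: nat
    and I :: "nat \<Rightarrow> 'a set"
    and b :: bracketing
  assumes "ring R"
    and "n \<ge> 4"
    and "m \<ge> 2"
    and "\<And>k. k \<in> {1..m} \<Longrightarrow> ideal (I k) R"
    and "num_factors b = m"
    and "cut_point b = s"
  shows "bracketed (mutual_commutator (GL R n)) b (\<lambda>k. elementary_subgroup R n (I k)) 1 =
    mutual_commutator (GL R n)
      (elementary_subgroup R n (bracketed (symmetrised_product R) (left_part b) I 1))
      (elementary_subgroup R n (bracketed (symmetrised_product R) (right_part b) I (s + 1)))"
proof -
  interpret ring R by (rule assms(1))
  interpret GL: group "GL R n" by (rule group_GL)
  define H where "H = elementary_subgroup R n (carrier R)"
  define G where "G = (GL R n)\<lparr>carrier := H\<rparr>"
  interpret S: steinberg R G n "transvection R n"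
    unfolding G_def H_def by (rule steinberg_transvection[OF assms(2)])
  have H: "subgroup H (GL R n)"
    unfolding H_def elementary_subgroup_def
    by (rule GL.generate_is_subgroup) (auto simp: transvection_GL)
  \<comment> \<open>\<open>S.E\<close> generates inside the restricted group \<open>G\<close>; as
    the generators lie in \<open>H\<close>, generation in \<open>GL R n\<close> gives the same
    set.\<close>
  have E: "S.E A = elementary_subgroup R n A" if "ideal A R" for A
  proof -
    have "{transvection R n i j a | i j a. i < n \<and> j < n \<and> i \<noteq> j \<and> a \<in> A} \<subseteq> H"
      using that unfolding H_def elementary_subgroup_def
      by (auto intro!: generate.incl dest: ideal.Icarr)
    from GL.generate_consistent[OF this H] show ?thesis
      unfolding S.E_def unfolding elementary_subgroup_def G_def .
  qed
  have E_subset: "elementary_subgroup R n A \<subseteq> H" if "ideal A R" for A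
    using S.ideal_E_carrier[OF that] unfolding E[OF that] by (simp add: G_def)
  obtain l r where b: "b = Bracket l r"
    using assms(3,5) by (cases b) auto
  \<comment> \<open>Hence the right part starts at position \<open>1 + num_factors l\<close>, which
    is \<open>s + 1\<close>.\<close>
  have s: "s = num_factors l"
    using assms(6) by (simp add: b cut_point_def)
  have ideals: "ideal (I j) R" if "1 \<le> j" "j < 1 + num_factors b" for j
    using that assms(4,5) by auto
  let ?L = "bracketed (symmetrised_product R) l I 1"
  let ?R = "bracketed (symmetrised_product R) r I (s + 1)"
  have "S.has_level (bracketed (mutual_commutator G) l (\<lambda>j. S.E (I j)) 1) ?L"
    "S.has_level (bracketed (mutual_commutator G) r (\<lambda>j. S.E (I j)) (s + 1)) ?R"
    using ideals by (auto intro!: S.bracketed_has_level simp: b s)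
  then have LR: "ideal ?L R" "ideal ?R R" by (simp_all add: S.has_level_def)
  \<comment> \<open>The \<open>I j\<close> are known to be ideals only at positions \<open>1\<close>
    to \<open>m\<close>, so \<open>S.E (I j)\<close> can be identified only there;
    \<open>bracketed\<close> looks at no other position.\<close>
  have cong: "bracketed f c F k = bracketed f c F' k"
    if "\<And>j. k \<le> j \<Longrightarrow> j < k + num_factors c \<Longrightarrow> F j = F' j"
    for f :: "'a mat set \<Rightarrow> 'a mat set \<Rightarrow> 'a mat set" and c F F' k
    using that
  proof (induction c arbitrary: k)
    case (Bracket c d)
    have "bracketed f c F k = bracketed f c F' k"
      "bracketed f d F (k + num_factors c) = bracketed f d F' (k + num_factors c)"
      by (intro Bracket; simp)+
    then show ?case by simp
  qed simp
  have "bracketed (mutual_commutator (GL R n)) b (\<lambda>k. elementary_subgroup R n (I k)) 1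
      = bracketed (mutual_commutator G) b (\<lambda>k. elementary_subgroup R n (I k)) 1"
    using GL.bracketed_mutual_commutator_consistent[OF H, of 1 b "\<lambda>k. elementary_subgroup R n (I k)"]
      E_subset ideals by (simp add: G_def)
  also have "\<dots> = bracketed (mutual_commutator G) b (\<lambda>k. S.E (I k)) 1"
    using ideals by (intro cong) (simp add: E)
  also have "\<dots> = mutual_commutator G (S.E ?L) (S.E ?R)"
    using S.bracketed_mutual_commutator[OF ideals[unfolded b]] by (simp only: b s add.commute)
  also have "\<dots> = mutual_commutator (GL R n) (elementary_subgroup R n ?L) (elementary_subgroup R n ?R)"
    unfolding E[OF LR(1)] E[OF LR(2)] unfolding G_def
    by (rule GL.mutual_commutator_consistent[OF H E_subset[OF LR(1)] E_subset[OF LR(2)]])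
  finally show ?thesis unfolding b bracketing.sel .
qed

end
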